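(* Let $s>5/3$. There exist two positive constants $c$ and $C$ and two sequences $(u_m)$ and $(v_m)$ of solutions in $C([0,1];H^s(\mathbb T^2))$ to the equation $$\partial_t w+\partial_x^3 w+\partial_x\partial_y^2 w+w\,\partial_x w=0,\qquad (x,y)\in\mathbb T^2,$$ such that, for every $m$, $$\sup_{t\in[0,1]}\big(\|u_m(t)\|_{H^s}+\|v_m(t)\|_{H^s}\big)\le C,$$ and satisfying initially $$\lim_{m\to+\infty}\|u_m(0)-v_m(0)\|_{H^s}=0,$$ but such that for every $t\in[0,1]$, $$\liminf_{m\to+\infty}\|u_m(t)-v_m(t)\|_{H^s}\ge c\,t.$$
   Context: $\mathbb T^2=\mathbb R^2/(2\pi\mathbb Z)^2$. Solutions are real-valued functions on $[0,1]\times\mathbb T^2$. $H^s=H^s(\mathbb T^2)$ is the usual $L^2$-based Sobolev space on the torus, with norm $\|f\|_{H^s}=\|J^sf\|_{L^2}$, where $J^s$ is the Fourier multiplier with symbol $(1+|\mathbf m|^2)^{s/2}$, $\mathbf m\in\mathbb Z^2$. *)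

theory Defs
  imports "HOL-Analysis.Analysis"
begin

text \<open>
  Functions on the torus \<open>\<real>\<^sup>2/(2\<pi>\<int>)\<^sup>2\<close> are represented by functions on the plane that are
  \<open>2\<pi>\<close>-periodic in each variable; integrals over the torus are Lebesgue integrals over a
  fundamental square.
\<close>

definition torus_periodic :: "(real \<times> real \<Rightarrow> 'b) \<Rightarrow> bool" where
  "torus_periodic f \<longleftrightarrow>
     (\<forall>x y. f (x + 2 * pi, y) = f (x, y) \<and> f (x, y + 2 * pi) = f (x, y))"

definition torus_square :: "(real \<times> real) set" where
  "torus_square = {0..2 * pi} \<times> {0..2 * pi}"

definition torus_L2 :: "(real \<times> real \<Rightarrow> real) set" where
  "torus_L2 = {f. torus_periodic f \<and> f \<in> borel_measurable borel \<and>
                  set_integrable lborel torus_square (\<lambda>z. (f z)\<^sup>2)}"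

definition torus_L2_norm :: "(real \<times> real \<Rightarrow> real) \<Rightarrow> real" where
  "torus_L2_norm f = sqrt (LINT z:torus_square|lborel. (f z)\<^sup>2)"

definition fourier_coeff :: "(real \<times> real \<Rightarrow> real) \<Rightarrow> int \<times> int \<Rightarrow> complex" where
  "fourier_coeff f m = (1 / (2 * pi)\<^sup>2) *\<^sub>R
     (LINT z:torus_square|lborel.
        of_real (f z) * cis (- (of_int (fst m) * fst z + of_int (snd m) * snd z)))"

definition J_symbol :: "real \<Rightarrow> int \<times> int \<Rightarrow> real" where
  "J_symbol s m = (1 + ((of_int (fst m))\<^sup>2 + (of_int (snd m))\<^sup>2)) powr (s / 2)"

definition is_J :: "real \<Rightarrow> (real \<times> real \<Rightarrow> real) \<Rightarrow> (real \<times> real \<Rightarrow> real) \<Rightarrow> bool" where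
  "is_J s f g \<longleftrightarrow> g \<in> torus_L2 \<and>
     (\<forall>m. fourier_coeff g m = of_real (J_symbol s m) * fourier_coeff f m)"

text \<open>
  An \<open>L\<^sup>2\<close> function is determined almost everywhere by its Fourier coefficients, so the choice
  below only selects a representative.  A real-valued \<open>g\<close> suffices because the symbol is real
  and even.
\<close>

definition J_op :: "real \<Rightarrow> (real \<times> real \<Rightarrow> real) \<Rightarrow> (real \<times> real \<Rightarrow> real)" where
  "J_op s f = (SOME g. is_J s f g)"

text \<open>
  The real-valued members of \<open>H\<^sup>s\<close>, for \<open>s \<ge> 0\<close> only, so that they are \<open>L\<^sup>2\<close> functions.
\<close>

definition Hs :: "real \<Rightarrow> (real \<times> real \<Rightarrow> real) set" where
  "Hs s = {f \<in> torus_L2. \<exists>g. is_J s f g}"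

definition Hs_norm :: "real \<Rightarrow> (real \<times> real \<Rightarrow> real) \<Rightarrow> real" where
  "Hs_norm s f = torus_L2_norm (J_op s f)"

definition C_unit_Hs :: "real \<Rightarrow> (real \<Rightarrow> real \<times> real \<Rightarrow> real) set" where
  "C_unit_Hs s = {w. (\<forall>t\<in>{0..1}. w t \<in> Hs s) \<and>
     (\<forall>t\<in>{0..1}. ((\<lambda>\<tau>. Hs_norm s (\<lambda>z. w \<tau> z - w t z)) \<longlongrightarrow> 0) (at t within {0..1}))}"

definition Dt :: "(real \<Rightarrow> real \<times> real \<Rightarrow> real) \<Rightarrow> real \<Rightarrow> real \<times> real \<Rightarrow> real" where
  "Dt \<psi> t z = deriv (\<lambda>\<tau>. \<psi> \<tau> z) t"

definition Dx :: "(real \<Rightarrow> real \<times> real \<Rightarrow> real) \<Rightarrow> real \<Rightarrow> real \<times> real \<Rightarrow> real" where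
  "Dx \<psi> t z = deriv (\<lambda>\<xi>. \<psi> t (\<xi>, snd z)) (fst z)"

definition Dy :: "(real \<Rightarrow> real \<times> real \<Rightarrow> real) \<Rightarrow> real \<Rightarrow> real \<times> real \<Rightarrow> real" where
  "Dy \<psi> t z = deriv (\<lambda>\<eta>. \<psi> t (fst z, \<eta>)) (snd z)"

primrec C_k :: "nat \<Rightarrow> (real \<Rightarrow> real \<times> real \<Rightarrow> real) \<Rightarrow> bool" where
  "C_k 0 \<psi> \<longleftrightarrow> continuous_on UNIV (\<lambda>(t, z). \<psi> t z)"
| "C_k (Suc k) \<psi> \<longleftrightarrow>
     (\<forall>t x y. (\<lambda>\<tau>. \<psi> \<tau> (x, y)) differentiable at t \<and>
              (\<lambda>\<xi>. \<psi> t (\<xi>, y)) differentiable at x \<and>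
              (\<lambda>\<eta>. \<psi> t (x, \<eta>)) differentiable at y) \<and>
     C_k k (Dt \<psi>) \<and> C_k k (Dx \<psi>) \<and> C_k k (Dy \<psi>)"

definition test_function :: "(real \<Rightarrow> real \<times> real \<Rightarrow> real) \<Rightarrow> bool" where
  "test_function \<psi> \<longleftrightarrow> (\<forall>k. C_k k \<psi>) \<and> (\<forall>t. torus_periodic (\<psi> t)) \<and>
     (\<exists>a b. 0 < a \<and> b < 1 \<and> (\<forall>t z. t \<notin> {a..b} \<longrightarrow> \<psi> t z = 0))"

text \<open>
  The equation \<open>\<partial>\<^sub>t w + \<partial>\<^sub>x\<^sup>3 w + \<partial>\<^sub>x \<partial>\<^sub>y\<^sup>2 w + w \<partial>\<^sub>x w = 0\<close> in the sense of distributions on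
  \<open>(0,1)\<close> times the torus, with \<open>w \<partial>\<^sub>x w = \<partial>\<^sub>x (w\<^sup>2/2)\<close>; an element of \<open>H\<^sup>s\<close> need not have
  classical derivatives of order three.  All derivatives moved onto the test function are of odd
  order, which gives a common sign.  The integral is iterated, since joint measurability in
  \<open>(t,z)\<close> depends on the representatives of \<open>w t\<close>; for \<open>w \<in> C([0,1]; H\<^sup>s)\<close> the inner
  integral is continuous in \<open>t\<close>.
\<close>

definition ZK_distributional :: "(real \<Rightarrow> real \<times> real \<Rightarrow> real) \<Rightarrow> bool" where
  "ZK_distributional w \<longleftrightarrow> (\<forall>\<psi>. test_function \<psi> \<longrightarrow>
     (LINT t:{0..1}|lborel. LINT z:torus_square|lborel.
        w t z * (Dt \<psi> t z + Dx (Dx (Dx \<psi>)) t z + Dx (Dy (Dy \<psi>)) t z)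
        + (w t z)\<^sup>2 / 2 * Dx \<psi> t z) = 0)"

definition ZK_solution :: "real \<Rightarrow> (real \<Rightarrow> real \<times> real \<Rightarrow> real) \<Rightarrow> bool" where
  "ZK_solution s w \<longleftrightarrow> w \<in> C_unit_Hs s \<and> ZK_distributional w"

end

theory Submission
  imports Defs "HOL-Real_Asymp.Real_Asymp"
begin

text \<open>
  The two sequences are explicit periodic travelling waves. Functions that do not depend on \<open>y\<close> turn
  the equation into the Korteweg-de Vries equation, whose cnoidal waves have a known Fourier series:
  up to normalisation, the coefficient at frequency \<open>k\<close> is \<open>k / sinh (k a)\<close>. That such a series solves
  the equation is the convolution identity \<open>cnoidal_convolution\<close>, which follows from the addition
  theorem of the hyperbolic cotangent.

  Rescaling gives a wave of wave number \<open>N\<close> with amplitude \<open>6 N\<^sup>2\<close>. The parameter \<open>a\<close> is chosen,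
  depending on \<open>N\<close> and \<open>s\<close>, so that the \<open>H\<^sup>s\<close> norm is of order one, and so is the contribution of the
  fundamental mode alone. The equation is invariant under the Galilean boost that adds a
  constant \<open>d\<close> to a solution and to its speed. The sequence \<open>v\<close> consists of the waves of mean
  zero, the sequence \<open>u\<close> of the same waves boosted by \<open>d = 1 / N\<close>. Initially they differ by the
  constant \<open>1 / N\<close>, which tends to zero. At time \<open>t\<close> the boosted wave is displaced by \<open>t / N\<close>, so
  its fundamental mode has turned by the angle \<open>t\<close>, and the difference has \<open>H\<^sup>s\<close> norm at least a
  constant times \<open>t\<close> (\<open>Hs_norm_diff_ge\<close>).

  Two facts connect these formulas with the definitions. The \<open>H\<^sup>s\<close> norm is defined through an arbitrary
  function with prescribed Fourier coefficients, so it can be computed only once an \<open>L\<^sup>2\<close> function is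
  known to be determined by its coefficients (\<open>torus_L2_norm_cong\<close>); this is proved with the
  Stone-Weierstrass theorem and inner regularity. The weak equation is tested mode by mode
  (\<open>ZK_distributional_travelling\<close>), with all derivatives on the test function, so that the Fourier
  series need not be differentiated.
\<close>

section \<open>Uniqueness of Fourier coefficients on the torus\<close>

definition torus :: "(real \<times> real) measure" where
  "torus = restrict_space lborel torus_square"

definition character :: "int \<times> int \<Rightarrow> real \<times> real \<Rightarrow> complex" where
  "character m z = cis (of_int (fst m) * fst z + of_int (snd m) * snd z)"

lemma torus_square_cbox: "torus_square = cbox (0, 0) (2 * pi, 2 * pi)"
  unfolding torus_square_def by (simp add: cbox_Pair_eq)

lemma torus_square_sets [measurable]: "torus_square \<in> sets borel"
  unfolding torus_square_cbox by simp

lemma compact_torus_square: "compact torus_square"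
  unfolding torus_square_cbox by (rule compact_cbox)

lemma space_torus: "space torus = torus_square"
  by (simp add: torus_def space_restrict_space)

lemma set_integral_torus:
  fixes f :: "real \<times> real \<Rightarrow> 'b::{banach,second_countable_topology}"
  shows "(LINT z:torus_square|lborel. f z) = integral\<^sup>L torus f"
  unfolding torus_def set_lebesgue_integral_def by (subst integral_restrict_space) auto

lemma set_integrable_torus:
  fixes f :: "real \<times> real \<Rightarrow> 'b::{banach,second_countable_topology}"
  shows "set_integrable lborel torus_square f \<longleftrightarrow> integrable torus f"
  unfolding torus_def set_integrable_def by (subst integrable_restrict_space) auto

lemma measurable_torus:
  "f \<in> borel_measurable borel \<Longrightarrow> f \<in> borel_measurable torus"
  unfolding torus_def by (rule measurable_restrict_space1) simp

lemma emeasure_torus: "emeasure torus (space torus) = ennreal ((2 * pi)\<^sup>2)"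
proof -
  have "emeasure torus (space torus) = emeasure lborel (cbox (0::real, 0::real) (2 * pi, 2 * pi))"
    unfolding torus_def space_restrict_space torus_square_cbox
    by (subst emeasure_restrict_space) auto
  also have "\<dots> = ennreal ((2 * pi)\<^sup>2)"
    by (subst emeasure_lborel_cbox)
       (auto simp: Basis_prod_def prod.union_disjoint power2_eq_square ennreal_mult)
  finally show ?thesis .
qed

lemma finite_measure_torus: "finite_measure torus"
  by (rule finite_measureI) (simp add: emeasure_torus)

lemma measure_torus: "measure torus (space torus) = (2 * pi)\<^sup>2"
  by (simp add: measure_def emeasure_torus)

lemma integrable_torus_bounded:
  fixes f :: "real \<times> real \<Rightarrow> 'b::{banach,second_countable_topology}"
  assumes "f \<in> borel_measurable borel" "\<And>z. norm (f z) \<le> B"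
  shows "integrable torus f"
  by (rule finite_measure.integrable_const_bound[OF finite_measure_torus, of _ B])
     (use assms in \<open>auto intro: measurable_torus\<close>)

lemma integrable_torus_mult_bounded:
  fixes f g :: "real \<times> real \<Rightarrow> complex"
  assumes "integrable torus f" "g \<in> borel_measurable borel" "\<And>z. norm (g z) \<le> B"
  shows "integrable torus (\<lambda>z. f z * g z)"
proof (rule Bochner_Integration.integrable_bound)
  show "integrable torus (\<lambda>z. B *\<^sub>R f z)" using assms(1) by (rule integrable_scaleR_right)
  have [measurable]: "g \<in> borel_measurable torus" "f \<in> borel_measurable torus"
    using assms by (auto intro: measurable_torus)
  show "(\<lambda>z. f z * g z) \<in> borel_measurable torus" by measurable
  have "norm (f z * g z) \<le> norm (B *\<^sub>R f z)" for z
    using mult_right_mono[OF order_trans[OF assms(3)[of z] abs_ge_self], of "norm (f z)"]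
    by (simp add: norm_mult mult.commute)
  thus "AE z in torus. norm (f z * g z) \<le> norm (B *\<^sub>R f z)" by simp
qed

lemma norm_character [simp]: "norm (character m z) = 1"
  by (simp add: character_def)

lemma character_add: "character (m + n) z = character m z * character n z"
  by (simp add: character_def cis_mult algebra_simps)

lemma continuous_character: "continuous_on S (character m)"
  unfolding character_def by (intro continuous_intros)

lemma measurable_character [measurable]: "character m \<in> borel_measurable borel"
  by (intro borel_measurable_continuous_onI continuous_character)

lemma fourier_coeff_eq:
  "fourier_coeff f m = (1 / (2 * pi)\<^sup>2) *\<^sub>R (\<integral>z. of_real (f z) * character (- m) z \<partial>torus)"
  unfolding fourier_coeff_def set_integral_torus character_def by (simp add: algebra_simps)

text \<open>
  Since \<open>m\<close> ranges over all of \<open>\<int>\<^sup>2\<close>, the character may be used here in place of its conjugate.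
\<close>

definition coeffs_vanish :: "(real \<times> real \<Rightarrow> complex) \<Rightarrow> bool" where
  "coeffs_vanish f \<longleftrightarrow> integrable torus f \<and> (\<forall>m. (\<integral>z. f z * character m z \<partial>torus) = 0)"

text \<open>
  Multiplication by a character only shifts the family of Fourier coefficients.
\<close>

lemma coeffs_vanish_character:
  assumes "coeffs_vanish f"
  shows "coeffs_vanish (\<lambda>z. f z * character m z)"
proof -
  have "(\<integral>z. f z * character m z * character n z \<partial>torus) = 0" for n
    using assms unfolding coeffs_vanish_def mult.assoc character_add[symmetric] by blast
  moreover have "integrable torus (\<lambda>z. f z * character m z)"
    using assms unfolding coeffs_vanish_def
    by (intro integrable_torus_mult_bounded[where B = 1]) auto
  ultimately show ?thesis unfolding coeffs_vanish_def by blast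
qed

lemma coeffs_vanish_add:
  assumes "coeffs_vanish f" "coeffs_vanish g"
  shows "coeffs_vanish (\<lambda>z. f z + g z)"
proof -
  have "integrable torus (\<lambda>z. f z * character m z)" "integrable torus (\<lambda>z. g z * character m z)" for m
    using assms unfolding coeffs_vanish_def
    by (auto intro!: integrable_torus_mult_bounded[where B = 1])
  thus ?thesis using assms unfolding coeffs_vanish_def by (auto simp: distrib_right)
qed

lemma coeffs_vanish_scale:
  assumes "coeffs_vanish f"
  shows "coeffs_vanish (\<lambda>z. f z * c)"
  using assms unfolding coeffs_vanish_def by (auto simp: mult.commute mult.left_commute)

text \<open>
  The coordinates of \<open>(cis x, cis y)\<close> are linear combinations of characters, so
  multiplication by one of them preserves the vanishing of all coefficients. The claim is made for
  every \<open>f\<close> at once: multiplication by a product of polynomials is then two successive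
  multiplications, and the induction closes.
\<close>

lemma coeffs_vanish_polynomial:
  fixes p :: "complex \<times> complex \<Rightarrow> real"
  assumes "real_polynomial_function p" "coeffs_vanish f"
  shows "coeffs_vanish (\<lambda>z. f z * of_real (p (cis (fst z), cis (snd z))))"
  using assms
proof (induction arbitrary: f rule: real_polynomial_function.induct)
  case (linear p)
  interpret p: bounded_linear p by fact
  define \<alpha> where "\<alpha> = complex_of_real (p (1, 0))"
  define \<beta> where "\<beta> = complex_of_real (p (\<i>, 0))"
  define \<gamma> where "\<gamma> = complex_of_real (p (0, 1))"
  define \<delta> where "\<delta> = complex_of_real (p (0, \<i>))"
  have "of_real (p (cis x, cis y)) =
      character (1, 0) (x, y) * ((\<alpha> - \<i> * \<beta>) / 2) + character (-1, 0) (x, y) * ((\<alpha> + \<i> * \<beta>) / 2) +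
      character (0, 1) (x, y) * ((\<gamma> - \<i> * \<delta>) / 2) + character (0, -1) (x, y) * ((\<gamma> + \<i> * \<delta>) / 2)"
    for x y
  proof -
    have "(cis x, cis y) = cos x *\<^sub>R (1, 0) + sin x *\<^sub>R (\<i>, 0) + cos y *\<^sub>R (0, 1) + sin y *\<^sub>R (0, \<i>)"
      by (auto simp: complex_eq_iff)
    hence "p (cis x, cis y) = cos x * p (1, 0) + sin x * p (\<i>, 0) + cos y * p (0, 1) + sin y * p (0, \<i>)"
      by (simp only: p.add p.scaleR real_scaleR_def)
    thus ?thesis
      by (simp add: \<alpha>_def \<beta>_def \<gamma>_def \<delta>_def character_def complex_eq_iff field_simps)
  qed
  hence eq: "f z * of_real (p (cis (fst z), cis (snd z))) =
      f z * character (1, 0) z * ((\<alpha> - \<i> * \<beta>) / 2) + f z * character (-1, 0) z * ((\<alpha> + \<i> * \<beta>) / 2) +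
      f z * character (0, 1) z * ((\<gamma> - \<i> * \<delta>) / 2) + f z * character (0, -1) z * ((\<gamma> + \<i> * \<delta>) / 2)" for z
    by (cases z) (simp add: algebra_simps)
  show ?case unfolding eq
    by (intro coeffs_vanish_add coeffs_vanish_scale coeffs_vanish_character linear)
next
  case (const c)
  show ?case by (rule coeffs_vanish_scale) fact
next
  case (add p q)
  thus ?case by (simp add: distrib_left coeffs_vanish_add)
next
  case (mult p q)
  from mult.IH(2)[OF mult.IH(1)[OF mult.prems]] show ?case by (simp add: mult.assoc)
qed

lemma coeffs_vanish_integral_zero:
  assumes "coeffs_vanish f" shows "integral\<^sup>L torus f = 0"
proof -
  have "(\<integral>z. f z * character 0 z \<partial>torus) = 0" using assms unfolding coeffs_vanish_def by blast
  thus ?thesis by (simp add: character_def)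
qed

text \<open>
  The map \<open>z \<mapsto> (cis (fst z), cis (snd z))\<close> embeds the torus in \<open>\<complex>\<^sup>2\<close> and glues opposite sides of
  the square, so the Stone-Weierstrass theorem on the product of two circles makes the preceding
  multipliers dense among the continuous ones.
\<close>

lemma coeffs_vanish_continuous:
  fixes F :: "complex \<times> complex \<Rightarrow> real"
  assumes f: "coeffs_vanish f" and F: "continuous_on UNIV F"
  shows "(\<integral>z. f z * of_real (F (cis (fst z), cis (snd z))) \<partial>torus) = 0"
proof -
  define \<pi> where "\<pi> z = (cis (fst z), cis (snd z))" for z :: "real \<times> real"
  let ?S = "sphere (0::complex) 1 \<times> sphere (0::complex) 1"
  have cS: "compact ?S" by (intro compact_Times) auto
  have \<pi>S: "\<pi> z \<in> ?S" for z by (simp add: \<pi>_def)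
  have cont\<pi>: "continuous_on UNIV \<pi>" unfolding \<pi>_def by (intro continuous_intros)
  have intf: "integrable torus f" using f by (simp add: coeffs_vanish_def)
  have cF: "continuous_on UNIV (\<lambda>z. complex_of_real (F (\<pi> z)))"
    by (intro continuous_on_of_real continuous_on_compose2[OF F cont\<pi>]) auto
  obtain B where B: "\<And>p. p \<in> ?S \<Longrightarrow> norm (F p) \<le> B"
    using compact_imp_bounded[OF compact_continuous_image[OF continuous_on_subset[OF F] cS]]
    by (auto simp: bounded_iff)
  have iF: "integrable torus (\<lambda>z. f z * of_real (F (\<pi> z)))"
    by (rule integrable_torus_mult_bounded[OF intf, of _ B])
       (use B \<pi>S in \<open>auto intro: borel_measurable_continuous_onI cF\<close>)
  have "norm (\<integral>z. f z * of_real (F (\<pi> z)) \<partial>torus) \<le> 0 + e" if "e > 0" for e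
  proof -
    define L where "L = (\<integral>z. norm (f z) \<partial>torus)"
    have L: "L \<ge> 0" by (simp add: L_def)
    define e' where "e' = e / (L + 1)"
    have e': "e' > 0" using that L by (simp add: e'_def)
    obtain p where p: "real_polynomial_function p" "\<And>w. w \<in> ?S \<Longrightarrow> \<bar>F w - p w\<bar> < e'"
      by (rule Stone_Weierstrass_real_polynomial_function[OF cS continuous_on_subset[OF F] e']) auto
    have cp: "coeffs_vanish (\<lambda>z. f z * of_real (p (\<pi> z)))"
      unfolding \<pi>_def by (rule coeffs_vanish_polynomial[OF p(1) f])
    have ip: "integrable torus (\<lambda>z. f z * of_real (p (\<pi> z)))"
      using cp by (simp add: coeffs_vanish_def)
    have "(\<integral>z. f z * of_real (F (\<pi> z)) \<partial>torus) =
        (\<integral>z. f z * of_real (F (\<pi> z)) - f z * of_real (p (\<pi> z)) \<partial>torus)"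
      using coeffs_vanish_integral_zero[OF cp] by (simp add: Bochner_Integration.integral_diff[OF iF ip])
    also have "norm \<dots> \<le> (\<integral>z. norm (f z * of_real (F (\<pi> z)) - f z * of_real (p (\<pi> z))) \<partial>torus)"
      by (rule integral_norm_bound)
    also have "\<dots> \<le> (\<integral>z. e' * norm (f z) \<partial>torus)"
    proof (rule integral_mono)
      fix z
      have "norm (f z * of_real (F (\<pi> z)) - f z * of_real (p (\<pi> z))) = norm (f z) * \<bar>F (\<pi> z) - p (\<pi> z)\<bar>"
        by (simp only: right_diff_distrib[symmetric] of_real_diff[symmetric] norm_mult norm_of_real)
      also have "\<dots> \<le> norm (f z) * e'"
        using less_imp_le[OF p(2)[OF \<pi>S[of z]]] by (intro mult_left_mono) simp_all
      finally show "norm (f z * of_real (F (\<pi> z)) - f z * of_real (p (\<pi> z))) \<le> e' * norm (f z)"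
        by (simp add: mult.commute)
    qed (use iF ip intf in auto)
    also have "\<dots> = e' * L" by (simp add: L_def)
    also have "\<dots> \<le> e" using that L by (simp add: e'_def field_simps)
    finally show ?thesis by simp
  qed
  hence "norm (\<integral>z. f z * of_real (F (\<pi> z)) \<partial>torus) \<le> 0" by (rule field_le_epsilon)
  thus ?thesis by (simp add: \<pi>_def)
qed

text \<open>
  Only \<open>y\<close> is an interior point of the period: this says that the embedding identifies no point
  of the closed square with a point of the open square other than itself.
\<close>

lemma cis_inj_fundamental:
  assumes "cis x = cis y" "0 \<le> x" "x \<le> 2 * pi" "0 < y" "y < 2 * pi"
  shows "x = y"
proof -
  have "cos (x - y) = 1" 
    using assms(1) by (simp add: cos_diff complex_eq_iff flip: power2_eq_square)
  then obtain n :: int where n: "x - y = of_int n * 2 * pi"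
    using cos_one_2pi_int by blast
  have "\<bar>x - y\<bar> < 2 * pi" using assms(2-) by (auto simp: abs_less_iff)
  hence "\<bar>of_int n :: real\<bar> * (2 * pi) < 1 * (2 * pi)"
    by (simp add: n abs_mult)
  hence "\<bar>of_int n :: real\<bar> < 1" by (simp only: mult_less_cancel_right) simp
  hence "n = 0" by linarith
  thus ?thesis using n by simp
qed

text \<open>
  The indicator of a compact set \<open>K\<close> is the pointwise limit of the continuous functions
  \<open>max 0 (1 - n dist)\<close>, the distance being taken to the image of \<open>K\<close> in \<open>\<complex>\<^sup>2\<close>. As \<open>K\<close> avoids the
  boundary of the square, no point outside \<open>K\<close> has the same image as a point of \<open>K\<close>.
\<close>

lemma coeffs_vanish_compact:
  assumes f: "coeffs_vanish f" and K: "compact K" "K \<subseteq> {0<..<2 * pi} \<times> {0<..<2 * pi}"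
  shows "(\<integral>z. f z * of_real (indicator K z) \<partial>torus) = 0"
proof (cases "K = {}")
  case True
  thus ?thesis by simp
next
  case False
  define \<pi> where "\<pi> z = (cis (fst z), cis (snd z))" for z :: "real \<times> real"
  define F where "F n p = max 0 (1 - real n * infdist p (\<pi> ` K))" for n p
  have cont\<pi>: "continuous_on UNIV \<pi>" unfolding \<pi>_def by (intro continuous_intros)
  have cK: "closed (\<pi> ` K)"
    by (intro compact_imp_closed compact_continuous_image K(1) continuous_on_subset[OF cont\<pi>]) simp
  have cF: "continuous_on UNIV (F n)" for n
    unfolding F_def by (intro continuous_intros)
  have F01: "norm (F n p) \<le> 1" for n p
    using infdist_nonneg[of p "\<pi> ` K"] by (simp add: F_def)
  have mF: "(\<lambda>z. complex_of_real (F n (\<pi> z))) \<in> borel_measurable borel" for n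
    by (intro borel_measurable_continuous_onI continuous_on_of_real
          continuous_on_compose2[OF cF cont\<pi>]) auto
  have intf: "integrable torus f" using f by (simp add: coeffs_vanish_def)
  hence mf: "f \<in> borel_measurable torus" by simp
  have lim: "(\<lambda>n. F n (\<pi> z)) \<longlonglongrightarrow> indicator K z" if z: "z \<in> torus_square" for z
  proof (cases "z \<in> K")
    case True
    hence "infdist (\<pi> z) (\<pi> ` K) = 0" by (simp add: infdist_zero)
    thus ?thesis using True by (simp add: F_def)
  next
    case nz: False
    have "\<pi> z \<notin> \<pi> ` K"
    proof
      assume "\<pi> z \<in> \<pi> ` K"
      then obtain w where w: "w \<in> K" "\<pi> z = \<pi> w" by blast
      have "fst z = fst w" "snd z = snd w"
        using w K(2) z by (auto simp: \<pi>_def torus_square_def intro!: cis_inj_fundamental)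
      hence "z = w" by (rule prod_eqI)
      thus False using w(1) nz by simp
    qed
    hence pos: "infdist (\<pi> z) (\<pi> ` K) > 0"
      using cK False in_closed_iff_infdist_zero[of "\<pi> ` K" "\<pi> z"] infdist_nonneg[of "\<pi> z" "\<pi> ` K"]
      by (auto simp: less_le)
    obtain N where N: "real N * infdist (\<pi> z) (\<pi> ` K) > 1"
      using reals_Archimedean3[OF pos] by blast
    have "\<forall>\<^sub>F n in sequentially. F n (\<pi> z) = 0"
      using eventually_ge_at_top[of N]
    proof eventually_elim
      case (elim n)
      have "real N * infdist (\<pi> z) (\<pi> ` K) \<le> real n * infdist (\<pi> z) (\<pi> ` K)"
        using elim pos by (intro mult_right_mono) auto
      thus ?case using N by (simp add: F_def)
    qed
    thus ?thesis using nz by (simp add: tendsto_eventually)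
  qed
  have "(\<lambda>n. \<integral>z. f z * of_real (F n (\<pi> z)) \<partial>torus) \<longlonglongrightarrow>
      (\<integral>z. f z * of_real (indicator K z) \<partial>torus)"
  proof (rule integral_dominated_convergence[where w = "\<lambda>z. norm (f z)"])
    show "(\<lambda>z. f z * of_real (indicator K z)) \<in> borel_measurable torus"
      using mf measurable_torus[of "indicator K :: _ \<Rightarrow> real"] compact_imp_closed[OF K(1)]
      by (intro borel_measurable_times borel_measurable_of_real) auto
    show "(\<lambda>z. f z * of_real (F n (\<pi> z))) \<in> borel_measurable torus" for n
      by (intro borel_measurable_times mf measurable_torus mF)
    show "integrable torus (\<lambda>z. norm (f z))" using intf by simp
    show "AE z in torus. (\<lambda>n. f z * of_real (F n (\<pi> z))) \<longlonglongrightarrow> f z * of_real (indicator K z)"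
      by (rule AE_I2) (intro tendsto_mult tendsto_const tendsto_of_real lim, simp add: space_torus)
    show "AE z in torus. norm (f z * of_real (F n (\<pi> z))) \<le> norm (f z)" for n
      using F01[of n] by (intro AE_I2) (simp add: norm_mult mult_left_le)
  qed
  moreover have "(\<integral>z. f z * of_real (F n (\<pi> z)) \<partial>torus) = 0" for n
    unfolding \<pi>_def by (rule coeffs_vanish_continuous[OF f cF])
  ultimately show ?thesis by (simp add: LIMSEQ_const_iff)
qed

text \<open>
  If the set where \<open>f\<close> is positive had positive measure, then by inner regularity it would contain
  a compact set of positive measure, and the integral of \<open>f\<close> over it would be positive.
\<close>

lemma null_of_vanishing_integrals:
  fixes f :: "real \<times> real \<Rightarrow> real"
  assumes f: "integrable torus f" "f \<in> borel_measurable borel"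
    and K: "\<And>K. compact K \<Longrightarrow> K \<subseteq> {0<..<2 * pi} \<times> {0<..<2 * pi} \<Longrightarrow>
              (\<integral>z. f z * indicator K z \<partial>torus) = 0"
  shows "AE z in lborel. z \<in> {0<..<2 * pi} \<times> {0<..<2 * pi} \<longrightarrow> f z \<le> 0"
proof -
  let ?Q = "{0<..<2 * pi} \<times> {0<..<2 * pi}"
  define P where "P = {z \<in> ?Q. f z > 0}"
  have oQ: "open ?Q" by (intro open_Times) auto
  have P: "P \<in> sets borel"
    unfolding P_def using f(2) borel_open[OF oQ] by measurable
  define \<mu> where "\<mu> = density lborel (indicator torus_square)"
  have \<mu>: "emeasure \<mu> A = emeasure lborel (torus_square \<inter> A)" if "A \<in> sets borel" for A
    using that by (simp add: \<mu>_def emeasure_density indicator_inter_arith[symmetric])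
  have \<mu>0: "emeasure \<mu> K = 0" if KP: "K \<subseteq> P" "compact K" for K
  proof -
    have mK: "K \<in> sets borel" using compact_imp_closed[OF KP(2)] by simp
    have int: "integrable torus (\<lambda>z. f z * indicator K z)"
      using mK f(1) by (intro Bochner_Integration.integrable_bound[OF f(1)] borel_measurable_times
          measurable_torus[of "indicator K"]) (auto simp: indicator_def)
    have "(\<integral>z. f z * indicator K z \<partial>torus) = 0"
      using KP by (intro K) (auto simp: P_def)
    hence "AE z in torus. f z * indicator K z = 0"
    proof (subst (asm) integral_nonneg_eq_0_iff_AE[OF int])
      show "AE z in torus. 0 \<le> f z * indicator K z"
        using KP(1) by (intro AE_I2) (auto simp: P_def indicator_def less_imp_le)
    qed
    hence "AE z in lborel. z \<in> torus_square \<longrightarrow> f z * indicator K z = 0"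
      unfolding torus_def by (subst (asm) AE_restrict_space_iff) auto
    hence "AE z in lborel. z \<notin> torus_square \<inter> K"
      by eventually_elim (use KP(1) in \<open>auto simp: P_def indicator_def\<close>)
    hence "torus_square \<inter> K \<in> null_sets lborel"
      using mK by (subst (asm) AE_iff_null_sets[symmetric]) auto
    thus ?thesis using mK by (simp add: \<mu> null_setsD1)
  qed
  have "emeasure \<mu> P = (SUP K \<in> {K. K \<subseteq> P \<and> compact K}. emeasure \<mu> K)"
  proof (rule inner_regular)
    show "sets \<mu> = sets borel" by (simp add: \<mu>_def)
    have "emeasure \<mu> UNIV = emeasure lborel torus_square" by (subst \<mu>) auto
    thus "emeasure \<mu> (space \<mu>) \<noteq> \<infinity>" 
      using emeasure_lborel_cbox_finite[of "(0::real,0::real)" "(2 * pi, 2 * pi)"]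
      by (simp add: \<mu>_def torus_square_cbox)
  qed (rule P)
  also have "\<dots> = (SUP K \<in> {K. K \<subseteq> P \<and> compact K}. 0)" by (intro SUP_cong) (auto simp: \<mu>0)
  also have "\<dots> = 0" by (rule antisym[OF SUP_least]) auto
  finally have "emeasure \<mu> P = 0" .
  moreover have "torus_square \<inter> P = P" by (auto simp: P_def torus_square_def)
  ultimately have "emeasure lborel P = 0" using \<mu>[OF P] by simp
  hence "P \<in> null_sets lborel" using P by (intro null_setsI) auto
  hence "AE z in lborel. z \<notin> P" by (rule AE_not_in)
  thus ?thesis by eventually_elim (auto simp: P_def not_less)
qed

lemma AE_open_square:
  assumes "AE z in lborel. z \<in> {0<..<2 * pi} \<times> {0<..<2 * pi} \<longrightarrow> P z"
  shows "AE z in torus. P z"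
proof -
  have "cbox (0::real, 0::real) (2 * pi, 2 * pi) - box (0, 0) (2 * pi, 2 * pi) \<in> null_sets lborel"
  proof (rule null_setsI)
    show "emeasure lborel (cbox (0::real, 0::real) (2 * pi, 2 * pi) - box (0, 0) (2 * pi, 2 * pi)) = 0"
      by (subst emeasure_Diff) (auto simp: box_subset_cbox emeasure_lborel_box_eq emeasure_lborel_cbox_eq)
  qed auto
  hence "AE z in lborel. z \<notin> cbox (0::real, 0::real) (2 * pi, 2 * pi) - box (0, 0) (2 * pi, 2 * pi)"
    by (rule AE_not_in)
  with assms have "AE z in lborel. z \<in> torus_square \<longrightarrow> P z"
    by eventually_elim (auto simp: torus_square_cbox box_prod)
  thus ?thesis unfolding torus_def by (subst AE_restrict_space_iff) auto
qed

lemma coeffs_vanish_AE_zero: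
  fixes f :: "real \<times> real \<Rightarrow> real"
  assumes "coeffs_vanish (\<lambda>z. of_real (f z))" and m: "f \<in> borel_measurable borel"
  shows "AE z in torus. f z = 0"
proof -
  have int: "integrable torus f"
    using assms(1) by (simp add: coeffs_vanish_def complex_of_real_integrable_eq)
  have K: "(\<integral>z. f z * indicator K z \<partial>torus) = 0"
    if "compact K" "K \<subseteq> {0<..<2 * pi} \<times> {0<..<2 * pi}" for K
  proof -
    have "complex_of_real (\<integral>z. f z * indicator K z \<partial>torus) = (\<integral>z. of_real (f z) * of_real (indicator K z) \<partial>torus)"
      by (simp flip: integral_complex_of_real)
    also have "\<dots> = 0" by (rule coeffs_vanish_compact[OF assms(1) that])
    finally show ?thesis by simp
  qed
  have 1: "AE z in torus. f z \<le> 0"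
    by (rule AE_open_square[OF null_of_vanishing_integrals[OF int m K]])
  have 2: "AE z in torus. - f z \<le> 0"
    by (rule AE_open_square[OF null_of_vanishing_integrals]) (use int m K in auto)
  from 1 2 show ?thesis by eventually_elim simp
qed

lemma torus_L2D:
  assumes "f \<in> torus_L2"
  shows "f \<in> borel_measurable borel" "integrable torus (\<lambda>z. (f z)\<^sup>2)" "integrable torus f"
proof -
  show 1: "f \<in> borel_measurable borel" "integrable torus (\<lambda>z. (f z)\<^sup>2)"
    using assms by (auto simp: torus_L2_def set_integrable_torus)
  show "integrable torus f"
    by (rule finite_measure.square_integrable_imp_integrable[OF finite_measure_torus measurable_torus[OF 1(1)] 1(2)])
qed

lemma torus_L2_norm_eq: "torus_L2_norm f = sqrt (\<integral>z. (f z)\<^sup>2 \<partial>torus)"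
  by (simp add: torus_L2_norm_def set_integral_torus)

text \<open>
  Uniqueness of Fourier coefficients, in the form that makes the \<open>H\<^sup>s\<close> norm independent of the
  representative selected by \<^const>\<open>J_op\<close>.
\<close>

lemma torus_L2_norm_cong:
  assumes f: "f \<in> torus_L2" and g: "g \<in> torus_L2"
    and eq: "\<And>m. fourier_coeff f m = fourier_coeff g m"
  shows "torus_L2_norm f = torus_L2_norm g"
proof -
  note F = torus_L2D[OF f] and G = torus_L2D[OF g]
  have int: "integrable torus (\<lambda>z. of_real (f z) * character m z)" 
    "integrable torus (\<lambda>z. of_real (g z) * character m z)" for m
    using F G by (auto intro!: integrable_torus_mult_bounded[where B = 1])
  have "(\<integral>z. of_real (f z) * character m z \<partial>torus) = (\<integral>z. of_real (g z) * character m z \<partial>torus)" for m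
    using eq[of "- m"] by (simp add: fourier_coeff_eq)
  hence "coeffs_vanish (\<lambda>z. of_real (f z - g z))"
    unfolding coeffs_vanish_def using F G int by (auto simp: left_diff_distrib)
  hence "AE z in torus. f z - g z = 0"
    using F G by (intro coeffs_vanish_AE_zero) auto
  hence "AE z in torus. (f z)\<^sup>2 = (g z)\<^sup>2" by eventually_elim simp
  hence "(\<integral>z. (f z)\<^sup>2 \<partial>torus) = (\<integral>z. (g z)\<^sup>2 \<partial>torus)"
    using F G by (intro integral_cong_AE borel_measurable_integrable)
  thus ?thesis by (simp add: torus_L2_norm_eq)
qed

lemma fourier_coeff_le_torus_L2_norm:
  assumes f: "f \<in> torus_L2"
  shows "2 * pi * norm (fourier_coeff f m) \<le> torus_L2_norm f"
proof -
  note F = torus_L2D[OF f]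
  interpret finite_measure torus by (rule finite_measure_torus)
  define I where "I = (\<integral>z. \<bar>f z\<bar> \<partial>torus)"
  \<comment> \<open>Cauchy-Schwarz, written as the nonnegativity of the variance of \<open>\<bar>f\<bar>\<close>, whose mean is \<open>c\<close>\<close>
  define c where "c = I / (2 * pi)\<^sup>2"
  have "norm (\<integral>z. of_real (f z) * character (- m) z \<partial>torus) \<le> I"
    using integral_norm_bound[of torus "\<lambda>z. of_real (f z) * character (- m) z"]
    by (simp add: norm_mult I_def)
  moreover have "I \<le> 2 * pi * torus_L2_norm f"
  proof -
    have "0 \<le> (\<integral>z. (\<bar>f z\<bar> - c)\<^sup>2 \<partial>torus)" by simp
    also have "\<dots> = (\<integral>z. (f z)\<^sup>2 - 2 * c * \<bar>f z\<bar> + c\<^sup>2 \<partial>torus)"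
      by (simp add: power2_diff algebra_simps)
    also have "\<dots> = (\<integral>z. (f z)\<^sup>2 \<partial>torus) - 2 * c * I + c\<^sup>2 * (2 * pi)\<^sup>2"
      using F by (simp add: I_def measure_torus)
    also have "\<dots> = (\<integral>z. (f z)\<^sup>2 \<partial>torus) - (I / (2 * pi))\<^sup>2"
      by (simp add: c_def field_simps power2_eq_square)
    finally have "(I / (2 * pi))\<^sup>2 \<le> (\<integral>z. (f z)\<^sup>2 \<partial>torus)" by simp
    hence "I / (2 * pi) \<le> torus_L2_norm f"
      unfolding torus_L2_norm_eq by (rule real_le_rsqrt)
    thus ?thesis by (simp add: field_simps)
  qed
  ultimately have "norm (\<integral>z. of_real (f z) * character (- m) z \<partial>torus) \<le> 2 * pi * torus_L2_norm f"
    by linarith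
  thus ?thesis
    by (simp add: fourier_coeff_eq field_simps power2_eq_square)
qed

lemma torus_L2_norm_le:
  assumes "\<And>z. \<bar>f z\<bar> \<le> B"
  shows "torus_L2_norm f \<le> 2 * pi * B"
proof -
  have B: "B \<ge> 0" using assms[of 0] by linarith
  have sq: "(f z)\<^sup>2 \<le> B\<^sup>2" for z using assms[of z] by (rule abs_le_square_iff[THEN iffD1, OF order_trans]) simp
  have "(\<integral>z. (f z)\<^sup>2 \<partial>torus) \<le> (\<integral>z. B\<^sup>2 \<partial>torus)"
    using finite_measure_torus sq 
    by (intro integral_mono_AE') (auto simp: finite_measure.integrable_const)
  also have "\<dots> = (2 * pi * B)\<^sup>2" by (simp add: measure_torus power_mult_distrib)
  finally have "torus_L2_norm f \<le> sqrt ((2 * pi * B)\<^sup>2)"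
    unfolding torus_L2_norm_eq by (rule real_sqrt_le_mono)
  thus ?thesis using B by (simp add: real_sqrt_unique)
qed

section \<open>Sobolev norms of absolutely convergent Fourier series\<close>

text \<open>
  Dominated convergence for a series over \<open>\<int>\<close>, obtained from the case of a series over \<open>\<nat>\<close> by
  enumerating the integers.
\<close>

lemma has_sum_integral:
  fixes f :: "int \<Rightarrow> 'a \<Rightarrow> complex"
  assumes f: "\<And>k. integrable M (f k)" and h: "integrable M h"
    and bound: "\<And>k x. x \<in> space M \<Longrightarrow> norm (f k x) \<le> B k * h x"
    and B: "B summable_on UNIV"
    and F: "\<And>x. x \<in> space M \<Longrightarrow> ((\<lambda>k. f k x) has_sum F x) UNIV"
  shows "((\<lambda>k. integral\<^sup>L M (f k)) has_sum integral\<^sup>L M F) UNIV"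
proof -
  have bij: "bij_betw int_decode UNIV UNIV" by (rule bij_int_decode)
  have sB: "summable (\<lambda>n. B (int_decode n))"
    using B summable_on_reindex_bij_betw[OF bij, of B] by (auto intro: summable_on_imp_summable)
  have Fs: "(\<lambda>n. f (int_decode n) x) sums F x" if "x \<in> space M" for x
    using F[OF that] has_sum_reindex_bij_betw[OF bij, of "\<lambda>k. f k x"] by (auto intro: has_sum_imp_sums)
  have 1: "AE x in M. summable (\<lambda>n. norm (f (int_decode n) x))"
  proof (rule AE_I2)
    fix x assume x: "x \<in> space M"
    show "summable (\<lambda>n. norm (f (int_decode n) x))"
      by (rule summable_comparison_test'[OF summable_mult2[OF sB, of "h x"], of 0])
         (use bound[OF x] in simp)
  qed
  have nb: "(\<integral>x. norm (f k x) \<partial>M) \<le> B k * integral\<^sup>L M h" for k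
  proof -
    have "(\<integral>x. norm (f k x) \<partial>M) \<le> (\<integral>x. B k * h x \<partial>M)"
      by (rule integral_mono) (use f h bound in auto)
    thus ?thesis by simp
  qed
  have 2: "summable (\<lambda>n. \<integral>x. norm (f (int_decode n) x) \<partial>M)"
    by (rule summable_comparison_test'[OF summable_mult2[OF sB, of "integral\<^sup>L M h"], of 0])
       (use nb in auto)
  note * = f 1 2
  have eq: "(\<Sum>n. f (int_decode n) x) = F x" if "x \<in> space M" for x
    using Fs[OF that] by (simp add: sums_iff)
  have "(\<lambda>n. integral\<^sup>L M (f (int_decode n))) sums (\<integral>x. (\<Sum>n. f (int_decode n) x) \<partial>M)"
    by (rule sums_integral[OF *])
  also have "(\<integral>x. (\<Sum>n. f (int_decode n) x) \<partial>M) = integral\<^sup>L M F"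
    by (rule Bochner_Integration.integral_cong) (use eq in auto)
  finally have sums: "(\<lambda>n. integral\<^sup>L M (f (int_decode n))) sums integral\<^sup>L M F" .
  have "norm (integral\<^sup>L M (f k)) \<le> B k * integral\<^sup>L M h" for k
    using integral_norm_bound[of M "f k"] nb[of k] by linarith
  hence "summable (\<lambda>n. norm (integral\<^sup>L M (f (int_decode n))))"
    by (intro summable_comparison_test'[OF summable_mult2[OF sB, of "integral\<^sup>L M h"], of 0]) auto
  from norm_summable_imp_has_sum[OF this sums]
  show "((\<lambda>k. integral\<^sup>L M (f k)) has_sum integral\<^sup>L M F) UNIV"
    using has_sum_reindex_bij_betw[OF bij, of "\<lambda>k. integral\<^sup>L M (f k)"] by blast
qed

text \<open>
  The symmetry of the Fourier coefficients of a real-valued function. Under it the real part in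
  the definition of \<open>wave\<close> below serves only to change the type.
\<close>

definition hermitian :: "(int \<Rightarrow> complex) \<Rightarrow> bool" where
  "hermitian c \<longleftrightarrow> (\<forall>k. c (- k) = cnj (c k))"

definition wave :: "int \<Rightarrow> (int \<Rightarrow> complex) \<Rightarrow> real \<times> real \<Rightarrow> real" where
  "wave N c z = Re (\<Sum>\<^sub>\<infinity>k. c k * character (N * k, 0) z)"

lemma abs_summable_wave:
  assumes "(\<lambda>k. norm (c k)) summable_on UNIV"
  shows "(\<lambda>k. norm (c k * character (\<nu> k) z)) summable_on UNIV"
  using assms by (simp add: norm_mult)

lemma has_sum_wave:
  assumes c: "(\<lambda>k. norm (c k)) summable_on UNIV" "hermitian c"
  shows "((\<lambda>k. c k * character (N * k, 0) z) has_sum of_real (wave N c z)) UNIV"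
proof -
  define S where "S = (\<Sum>\<^sub>\<infinity>k. c k * character (N * k, 0) z)"
  have "cnj S = (\<Sum>\<^sub>\<infinity>k. cnj (c k * character (N * k, 0) z))" by (simp only: S_def infsum_cnj)
  also have "\<dots> = (\<Sum>\<^sub>\<infinity>k. c (- k) * character (N * (- k), 0) z)"
    using c(2) by (intro infsum_cong) (simp add: hermitian_def character_def cis_cnj)
  also have "\<dots> = S"
    unfolding S_def by (rule infsum_reindex_bij_betw) (rule bij_uminus)
  finally have "of_real (Re S) = S" by (simp add: complex_eq_iff)
  moreover have "((\<lambda>k. c k * character (N * k, 0) z) has_sum S) UNIV"
    unfolding S_def by (rule has_sum_infsum[OF abs_summable_summable[OF abs_summable_wave[OF c(1)]]])
  ultimately show ?thesis unfolding wave_def S_def by simp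
qed

lemma wave_le:
  assumes "(\<lambda>k. norm (c k)) summable_on UNIV"
  shows "\<bar>wave N c z\<bar> \<le> (\<Sum>\<^sub>\<infinity>k. norm (c k))"
proof -
  have "\<bar>wave N c z\<bar> \<le> norm (\<Sum>\<^sub>\<infinity>k. c k * character (N * k, 0) z)"
    unfolding wave_def by (rule abs_Re_le_cmod)
  also have "\<dots> \<le> (\<Sum>\<^sub>\<infinity>k. norm (c k * character (N * k, 0) z))"
    by (rule norm_infsum_bound[OF abs_summable_wave[OF assms]])
  finally show ?thesis by (simp add: norm_mult)
qed

lemma wave_diff:
  assumes "(\<lambda>k. norm (c k)) summable_on UNIV" "(\<lambda>k. norm (d k)) summable_on UNIV"
  shows "wave N c z - wave N d z = wave N (\<lambda>k. c k - d k) z"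
proof -
  have "((\<lambda>k. c k * character (N * k, 0) z - d k * character (N * k, 0) z) has_sum
     ((\<Sum>\<^sub>\<infinity>k. c k * character (N * k, 0) z) - (\<Sum>\<^sub>\<infinity>k. d k * character (N * k, 0) z))) UNIV"
    unfolding diff_conv_add_uminus
    by (intro has_sum_add has_sum_uminusI
          has_sum_infsum[OF abs_summable_summable[OF abs_summable_wave[OF assms(1)]]]
          has_sum_infsum[OF abs_summable_summable[OF abs_summable_wave[OF assms(2)]]])
  from infsumI[OF this] show ?thesis by (simp add: wave_def left_diff_distrib)
qed

lemma torus_periodic_wave: "torus_periodic (wave N c)"
proof -
  have "character (N * k, 0) (x + 2 * pi, y) = character (N * k, 0) (x, y)" for k x y
  proof -
    have "character (N * k, 0) (x + 2 * pi, y) = cis (of_int (N * k) * x) * cis (2 * pi * of_int (N * k))"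
      by (simp add: character_def cis_mult algebra_simps)
    thus ?thesis by (simp add: character_def)
  qed
  thus ?thesis by (auto simp: torus_periodic_def wave_def character_def)
qed

lemma continuous_wave:
  assumes c: "(\<lambda>k. norm (c k)) summable_on UNIV"
  shows "continuous_on UNIV (wave N c)"
proof -
  have "uniform_limit UNIV (\<lambda>X z. \<Sum>k\<in>X. c k * character (N * k, 0) z)
     (\<lambda>z. \<Sum>\<^sub>\<infinity>k. c k * character (N * k, 0) z) (finite_subsets_at_top UNIV)"
    by (rule Weierstrass_m_test_general[OF _ c]) (simp add: norm_mult)
  hence "continuous_on UNIV (\<lambda>z. \<Sum>\<^sub>\<infinity>k. c k * character (N * k, 0) z)"
    by (rule uniform_limit_theorem[rotated])
       (auto intro!: always_eventually continuous_on_sum continuous_on_mult continuous_character continuous_on_const)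
  thus ?thesis unfolding wave_def by (intro continuous_on_Re)
qed

lemma wave_in_torus_L2:
  assumes c: "(\<lambda>k. norm (c k)) summable_on UNIV"
  shows "wave N c \<in> torus_L2"
proof -
  have m: "wave N c \<in> borel_measurable borel"
    by (intro borel_measurable_continuous_onI continuous_wave c)
  have "norm ((wave N c z)\<^sup>2) \<le> (\<Sum>\<^sub>\<infinity>k. norm (c k))\<^sup>2" for z
    using power_mono[OF wave_le[OF c, of N z], of 2] by simp
  hence "integrable torus (\<lambda>z. (wave N c z)\<^sup>2)"
    using m by (intro integrable_torus_bounded) auto
  thus ?thesis using m torus_periodic_wave by (simp add: torus_L2_def set_integrable_torus)
qed

lemma integral_torus_continuous:
  fixes f :: "real \<times> real \<Rightarrow> complex"
  assumes "continuous_on UNIV f"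
  shows "integrable torus f"
    "integral\<^sup>L torus f = integral torus_square f"
    "integral\<^sup>L torus f = integral {0..2 * pi} (\<lambda>x. integral {0..2 * pi} (\<lambda>y. f (x, y)))"
proof -
  have 1: "set_integrable lborel torus_square f"
    unfolding set_integrable_def
    by (intro borel_integrable_compact compact_torus_square continuous_on_subset[OF assms]) simp
  thus "integrable torus f" by (simp add: set_integrable_torus)
  show 2: "integral\<^sup>L torus f = integral torus_square f"
    using set_borel_integral_eq_integral(2)[OF 1] by (simp add: set_integral_torus)
  also have "\<dots> = integral {0..2 * pi} (\<lambda>x. integral {0..2 * pi} (\<lambda>y. f (x, y)))"
    unfolding torus_square_cbox cbox_interval[symmetric]
    by (intro integral_prod_continuous continuous_on_subset[OF assms]) simp
  finally show "integral\<^sup>L torus f = integral {0..2 * pi} (\<lambda>x. integral {0..2 * pi} (\<lambda>y. f (x, y)))" .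
qed

lemma integral_cis_period:
  fixes n :: int
  shows "integral {0..2 * pi} (\<lambda>x. cis (of_int n * x)) = (if n = 0 then of_real (2 * pi) else 0)"
proof (cases "n = 0")
  case False
  have "((\<lambda>x. cis (of_int n * x) / (\<i> * of_int n)) has_vector_derivative cis (of_int n * x)) (at x within A)" for x A
    unfolding has_vector_derivative_complex_iff using False
    by (auto intro!: derivative_eq_intros simp: Re_divide Im_divide complex_eq_iff power2_eq_square field_simps)
  hence "((\<lambda>x. cis (of_int n * x)) has_integral
      (cis (of_int n * (2 * pi)) / (\<i> * of_int n) - cis (of_int n * 0) / (\<i> * of_int n))) {0..2 * pi}"
    by (intro fundamental_theorem_of_calculus) auto
  moreover have "cis (of_int n * (2 * pi)) = 1"
    using cis_multiple_2pi[of "of_int n"] by (simp add: mult.commute)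
  ultimately show ?thesis using False by (simp add: integral_unique)
qed (simp add: scaleR_conv_of_real)

lemma integral_character:
  "(\<integral>z. character m z \<partial>torus) = (if m = 0 then of_real ((2 * pi)\<^sup>2) else 0)"
proof -
  have "(\<integral>z. character m z \<partial>torus) =
      integral {0..2 * pi} (\<lambda>x. cis (of_int (fst m) * x) * integral {0..2 * pi} (\<lambda>y. cis (of_int (snd m) * y)))"
    unfolding integral_torus_continuous(3)[OF continuous_character]
    by (simp add: character_def flip: cis_mult)
  also have "\<dots> = integral {0..2 * pi} (\<lambda>x. cis (of_int (fst m) * x)) * integral {0..2 * pi} (\<lambda>y. cis (of_int (snd m) * y))"
    by simp
  finally show ?thesis unfolding integral_cis_period 
    by (simp add: prod_eq_iff power2_eq_square)
qed

text \<open>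
  The right-hand side has at most one nonzero term if \<open>N \<noteq> 0\<close>. Keeping it as a sum spares the case
  distinction whether \<open>N\<close> divides the first component of \<open>m\<close>.
\<close>

lemma fourier_coeff_wave:
  assumes c: "(\<lambda>k. norm (c k)) summable_on UNIV" "hermitian c"
  shows "fourier_coeff (wave N c) m = (\<Sum>\<^sub>\<infinity>k. if (N * k, 0) = m then c k else 0)"
proof -
  have "((\<lambda>k. \<integral>z. c k * character (N * k, 0) z * character (- m) z \<partial>torus) has_sum
      (\<integral>z. of_real (wave N c z) * character (- m) z \<partial>torus)) UNIV"
  proof (rule has_sum_integral[where B = "\<lambda>k. norm (c k)" and h = "\<lambda>_. 1"])
    show "integrable torus (\<lambda>z. c k * character (N * k, 0) z * character (- m) z)" for k
      by (intro integral_torus_continuous(1) continuous_intros continuous_character)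
    show "integrable torus (\<lambda>_. 1 :: real)"
      using finite_measure.integrable_const[OF finite_measure_torus] .
    show "((\<lambda>k. c k * character (N * k, 0) z * character (- m) z) has_sum
        of_real (wave N c z) * character (- m) z) UNIV" for z
      by (intro has_sum_cmult_left has_sum_wave c)
  qed (use c(1) in \<open>auto simp: norm_mult\<close>)
  also have "(\<lambda>k. \<integral>z. c k * character (N * k, 0) z * character (- m) z \<partial>torus) =
      (\<lambda>k. of_real ((2 * pi)\<^sup>2) * (if (N * k, 0) = m then c k else 0))"
    unfolding mult.assoc character_add[symmetric]
    by (auto simp: integral_character fun_eq_iff prod_eq_iff)
  finally have "(\<integral>z. of_real (wave N c z) * character (- m) z \<partial>torus) =
      (\<Sum>\<^sub>\<infinity>k. of_real ((2 * pi)\<^sup>2) * (if (N * k, 0) = m then c k else 0))"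
    by (simp add: infsumI)
  also have "\<dots> = of_real ((2 * pi)\<^sup>2) * (\<Sum>\<^sub>\<infinity>k. if (N * k, 0) = m then c k else 0)"
    by (rule infsum_cmult_right')
  finally show ?thesis by (simp add: fourier_coeff_eq scaleR_conv_of_real)
qed

definition weight :: "real \<Rightarrow> int \<Rightarrow> int \<Rightarrow> real" where
  "weight s N k = J_symbol s (N * k, 0)"

lemma weight_pos: "weight s N k > 0"
proof -
  have "1 + ((of_int (N * k))\<^sup>2 + (0::real)\<^sup>2) > 0" by (intro add_pos_nonneg) auto
  thus ?thesis by (simp add: weight_def J_symbol_def)
qed

lemma weight_ge_1: "s \<ge> 0 \<Longrightarrow> weight s N k \<ge> 1"
  by (auto simp: weight_def J_symbol_def intro!: ge_one_powr_ge_zero)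

lemma hermitian_weight: "hermitian c \<Longrightarrow> hermitian (\<lambda>k. of_real (weight s N k) * c k)"
  by (simp add: hermitian_def weight_def J_symbol_def)

definition Hs_wave_coeffs :: "real \<Rightarrow> int \<Rightarrow> (int \<Rightarrow> complex) \<Rightarrow> bool" where
  "Hs_wave_coeffs s N c \<longleftrightarrow> hermitian c \<and> (\<lambda>k. weight s N k * norm (c k)) summable_on UNIV"

lemma Hs_wave_coeffs_summable:
  assumes "s \<ge> 0" "Hs_wave_coeffs s N c"
  shows "(\<lambda>k. norm (c k)) summable_on UNIV"
proof (rule summable_on_comparison_test)
  show "(\<lambda>k. weight s N k * norm (c k)) summable_on UNIV" using assms by (simp add: Hs_wave_coeffs_def)
  show "norm (c k) \<le> weight s N k * norm (c k)" for k
    using mult_right_mono[OF weight_ge_1[OF assms(1), of N k], of "norm (c k)"] by simp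
qed auto

text \<open>
  Both sides of the defining condition of \<open>J\<^sup>s\<close> can be compared term by term, because the weight is
  the symbol at the frequency that carries the \<open>k\<close>-th coefficient.
\<close>

lemma is_J_wave:
  assumes s: "s \<ge> 0" and c: "Hs_wave_coeffs s N c"
  shows "is_J s (wave N c) (wave N (\<lambda>k. of_real (weight s N k) * c k))"
proof -
  have h: "hermitian c" using c by (simp add: Hs_wave_coeffs_def)
  have J: "(\<lambda>k. norm (of_real (weight s N k) * c k)) summable_on UNIV"
    using c weight_pos[of s N] by (simp add: Hs_wave_coeffs_def norm_mult abs_of_pos)
  have "fourier_coeff (wave N (\<lambda>k. of_real (weight s N k) * c k)) m = of_real (J_symbol s m) * fourier_coeff (wave N c) m" for m
    unfolding fourier_coeff_wave[OF J hermitian_weight[OF h]]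
      fourier_coeff_wave[OF Hs_wave_coeffs_summable[OF s c] h] infsum_cmult_right'[symmetric]
    by (intro infsum_cong) (auto simp: weight_def)
  thus ?thesis using wave_in_torus_L2[OF J] by (simp add: is_J_def)
qed

lemma wave_in_Hs:
  assumes "s \<ge> 0" "Hs_wave_coeffs s N c"
  shows "wave N c \<in> Hs s"
  using is_J_wave[OF assms] wave_in_torus_L2[OF Hs_wave_coeffs_summable[OF assms]] by (auto simp: Hs_def)

lemma Hs_norm_is_J:
  assumes "is_J s f g"
  shows "Hs_norm s f = torus_L2_norm g"
proof -
  have "is_J s f (J_op s f)" unfolding J_op_def by (rule someI[of "is_J s f", OF assms])
  thus ?thesis using assms unfolding Hs_norm_def is_J_def by (intro torus_L2_norm_cong) auto
qed

text \<open>
  The \<open>L\<^sup>2\<close> norm of \<open>J\<^sup>s f\<close> is bounded by its supremum. This costs nothing essential for the waves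
  below, whose coefficients decay geometrically.
\<close>

lemma Hs_norm_wave_le:
  assumes s: "s \<ge> 0" and c: "Hs_wave_coeffs s N c"
  shows "Hs_norm s (wave N c) \<le> 2 * pi * (\<Sum>\<^sub>\<infinity>k. weight s N k * norm (c k))"
proof -
  have "norm (of_real (weight s N k) * c k) = weight s N k * norm (c k)" for k
    using weight_pos[of s N k] by (simp add: norm_mult)
  thus ?thesis
    using c torus_L2_norm_le[OF wave_le[of "\<lambda>k. of_real (weight s N k) * c k" N]]
    unfolding Hs_norm_is_J[OF is_J_wave[OF assms]] by (simp add: Hs_wave_coeffs_def)
qed

lemma Hs_norm_wave_ge:
  assumes s: "s \<ge> 0" and c: "Hs_wave_coeffs s N c" and N: "N \<noteq> 0"
  shows "2 * pi * (weight s N k * norm (c k)) \<le> Hs_norm s (wave N c)"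
proof -
  have J: "is_J s (wave N c) (wave N (\<lambda>k. of_real (weight s N k) * c k))" by (rule is_J_wave[OF s c])
  have "fourier_coeff (wave N c) (N * k, 0) = (\<Sum>\<^sub>\<infinity>j\<in>{k}. c j)"
    unfolding fourier_coeff_wave[OF Hs_wave_coeffs_summable[OF s c] c[unfolded Hs_wave_coeffs_def, THEN conjunct1]]
    using N by (intro infsum_cong_neutral) auto
  hence "fourier_coeff (wave N (\<lambda>k. of_real (weight s N k) * c k)) (N * k, 0) = of_real (weight s N k) * c k"
    using J by (simp add: is_J_def weight_def)
  moreover have "norm (of_real (weight s N k) * c k) = weight s N k * norm (c k)"
    using weight_pos[of s N k] by (simp add: norm_mult)
  ultimately show ?thesis
    using fourier_coeff_le_torus_L2_norm[of "wave N (\<lambda>k. of_real (weight s N k) * c k)" "(N * k, 0)"] J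
    unfolding Hs_norm_is_J[OF J] by (simp add: is_J_def)
qed

section \<open>The weak equation on superpositions of travelling modes\<close>

definition smooth :: "(real \<Rightarrow> real \<times> real \<Rightarrow> real) \<Rightarrow> bool" where
  "smooth \<psi> \<longleftrightarrow> (\<forall>k. C_k k \<psi>)"

lemma smoothD:
  assumes "smooth \<psi>"
  shows "smooth (Dt \<psi>)" "smooth (Dx \<psi>)" "smooth (Dy \<psi>)"
    "continuous_on UNIV (\<lambda>(t, z). \<psi> t z)"
    "((\<lambda>\<tau>. \<psi> \<tau> (x, y)) has_vector_derivative Dt \<psi> t (x, y)) (at t within A)"
    "((\<lambda>\<xi>. \<psi> t (\<xi>, y)) has_vector_derivative Dx \<psi> t (x, y)) (at x within A)"
    "((\<lambda>\<eta>. \<psi> t (x, \<eta>)) has_vector_derivative Dy \<psi> t (x, y)) (at y within A)"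
proof -
  have S: "C_k (Suc k) \<psi>" for k using assms by (simp add: smooth_def)
  show "smooth (Dt \<psi>)" "smooth (Dx \<psi>)" "smooth (Dy \<psi>)" using S by (simp_all add: smooth_def)
  have "C_k 0 \<psi>" using assms unfolding smooth_def by blast
  thus "continuous_on UNIV (\<lambda>(t, z). \<psi> t z)" by simp
  have "(\<lambda>\<tau>. \<psi> \<tau> (x, y)) differentiable at t" "(\<lambda>\<xi>. \<psi> t (\<xi>, y)) differentiable at x"
     "(\<lambda>\<eta>. \<psi> t (x, \<eta>)) differentiable at y" using S by simp_all
  thus "((\<lambda>\<tau>. \<psi> \<tau> (x, y)) has_vector_derivative Dt \<psi> t (x, y)) (at t within A)"
    "((\<lambda>\<xi>. \<psi> t (\<xi>, y)) has_vector_derivative Dx \<psi> t (x, y)) (at x within A)"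
    "((\<lambda>\<eta>. \<psi> t (x, \<eta>)) has_vector_derivative Dy \<psi> t (x, y)) (at y within A)"
    by (auto simp: Dt_def Dx_def Dy_def real_differentiable_def field_differentiable_def
          has_real_derivative_iff_has_vector_derivative[symmetric]
          intro!: DERIV_subset[OF DERIV_deriv_iff_real_differentiable[THEN iffD2]])
qed

lemma torus_periodic_derivatives:
  assumes "\<And>t. torus_periodic (\<psi> t)"
  shows "torus_periodic (Dx \<psi> t)" "torus_periodic (Dy \<psi> t)"
proof -
  have shift: "deriv f (x + p) = deriv (\<lambda>\<xi>. f (\<xi> + p)) x" for f :: "real \<Rightarrow> real" and x p
    unfolding deriv_def DERIV_shift ..
  show "torus_periodic (Dx \<psi> t)" "torus_periodic (Dy \<psi> t)"
    using assms unfolding torus_periodic_def Dx_def Dy_def by (simp_all add: shift)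
qed

text \<open>
  The pairing in the weak equation, for complex-valued integrands, so that it can be evaluated on
  single modes.
\<close>

definition spacetime_integral :: "(real \<Rightarrow> real \<times> real \<Rightarrow> complex) \<Rightarrow> complex" where
  "spacetime_integral \<Phi> = (LINT t:{0..1}|lborel. LINT z:torus_square|lborel. \<Phi> t z)"

definition jointly_continuous :: "(real \<Rightarrow> real \<times> real \<Rightarrow> complex) \<Rightarrow> bool" where
  "jointly_continuous \<Phi> \<longleftrightarrow> continuous_on UNIV (\<lambda>(t, z). \<Phi> t z)"

lemma jointly_continuous_compose:
  assumes "jointly_continuous \<Phi>" "continuous_on A f" "continuous_on A g"
  shows "continuous_on A (\<lambda>a. \<Phi> (f a) (g a))"
  using continuous_on_compose2[OF assms(1)[unfolded jointly_continuous_def] continuous_on_Pair[OF assms(2,3)]]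
  by simp

lemma jointly_continuous_slice:
  "jointly_continuous \<Phi> \<Longrightarrow> continuous_on A (\<Phi> t)"
  by (drule jointly_continuous_compose[of _ A "\<lambda>_. t" "\<lambda>z. z"]) auto

lemma jointly_continuous_add:
  "jointly_continuous \<Phi> \<Longrightarrow> jointly_continuous \<Psi> \<Longrightarrow> jointly_continuous (\<lambda>t z. \<Phi> t z + \<Psi> t z)"
  unfolding jointly_continuous_def case_prod_unfold by (rule continuous_on_add)

lemma jointly_continuous_cmult:
  "jointly_continuous \<Phi> \<Longrightarrow> jointly_continuous (\<lambda>t z. c * \<Phi> t z)"
  unfolding jointly_continuous_def case_prod_unfold by (rule continuous_on_mult_left)

lemma spacetime_integral_eq:
  assumes "jointly_continuous \<Phi>"
  shows "continuous_on {0..1} (\<lambda>t. integral\<^sup>L torus (\<Phi> t))"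
    "spacetime_integral \<Phi> = (LINT t:{0..1}|lborel. integral\<^sup>L torus (\<Phi> t))"
    "spacetime_integral \<Phi> = integral {0..1} (\<lambda>t. integral torus_square (\<Phi> t))"
proof -
  have eq: "integral\<^sup>L torus (\<Phi> t) = integral torus_square (\<Phi> t)" for t
    by (rule integral_torus_continuous(2)) (rule jointly_continuous_slice[OF assms])
  have "continuous_on {0..1} (\<lambda>t. integral (cbox (0,0) (2 * pi, 2 * pi)) (\<Phi> t))"
    by (rule integral_continuous_on_param) (rule continuous_on_subset[OF assms[unfolded jointly_continuous_def]], simp)
  thus 1: "continuous_on {0..1} (\<lambda>t. integral\<^sup>L torus (\<Phi> t))"
    by (simp add: eq torus_square_cbox)
  show 2: "spacetime_integral \<Phi> = (LINT t:{0..1}|lborel. integral\<^sup>L torus (\<Phi> t))"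
    by (simp add: spacetime_integral_def set_integral_torus)
  show "spacetime_integral \<Phi> = integral {0..1} (\<lambda>t. integral torus_square (\<Phi> t))"
    unfolding 2 set_borel_integral_eq_integral(2)[OF borel_integrable_atLeastAtMost'[OF 1]] by (simp add: eq)
qed

lemma spacetime_integral_add:
  assumes "jointly_continuous \<Phi>" "jointly_continuous \<Psi>"
  shows "spacetime_integral (\<lambda>t z. \<Phi> t z + \<Psi> t z) = spacetime_integral \<Phi> + spacetime_integral \<Psi>"
proof -
  have i: "integrable torus (\<Phi> t)" "integrable torus (\<Psi> t)" for t
    by (intro integral_torus_continuous(1) jointly_continuous_slice assms)+
  have "set_integrable lborel {0..1} (\<lambda>t. integral\<^sup>L torus (\<Phi> t))"
    "set_integrable lborel {0..1} (\<lambda>t. integral\<^sup>L torus (\<Psi> t))"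
    by (intro borel_integrable_atLeastAtMost' spacetime_integral_eq(1) assms)+
  thus ?thesis 
    by (simp add: spacetime_integral_def set_integral_torus i set_integral_add)
qed

lemma spacetime_integral_cmult:
  "spacetime_integral (\<lambda>t z. c * \<Phi> t z) = c * spacetime_integral \<Phi>"
  by (simp add: spacetime_integral_def)

text \<open>
  By Fubini it is enough that the integrals along all lines parallel to one coordinate axis
  vanish. The next three lemmas treat the three axes.
\<close>

lemma spacetime_integral_zero_t:
  assumes c: "jointly_continuous \<Phi>" and 0: "\<And>z. integral {0..1} (\<lambda>t. \<Phi> t z) = 0"
  shows "spacetime_integral \<Phi> = 0"
proof -
  have "integral (cbox 0 1) (\<lambda>t. integral (cbox (0,0) (2 * pi, 2 * pi)) (\<Phi> t)) =
     integral (cbox (0,0) (2 * pi, 2 * pi)) (\<lambda>z. integral (cbox 0 1) (\<lambda>t. \<Phi> t z))"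
    by (rule integral_swap_continuous) (rule continuous_on_subset[OF c[unfolded jointly_continuous_def]], simp)
  thus ?thesis unfolding spacetime_integral_eq(3)[OF c] by (simp add: torus_square_cbox 0)
qed

lemma spacetime_integral_zero_y:
  assumes c: "jointly_continuous \<Phi>" and 0: "\<And>t x. integral {0..2 * pi} (\<lambda>y. \<Phi> t (x, y)) = 0"
  shows "spacetime_integral \<Phi> = 0"
  unfolding spacetime_integral_eq(2)[OF c]
    integral_torus_continuous(3)[OF jointly_continuous_slice[OF c]] 0
  by simp

lemma spacetime_integral_zero_x:
  assumes c: "jointly_continuous \<Phi>" and 0: "\<And>t y. integral {0..2 * pi} (\<lambda>x. \<Phi> t (x, y)) = 0"
  shows "spacetime_integral \<Phi> = 0"
proof -
  have "integral (cbox 0 (2 * pi)) (\<lambda>x. integral (cbox 0 (2 * pi)) (\<lambda>y. \<Phi> t (x, y))) =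
     integral (cbox 0 (2 * pi)) (\<lambda>y. integral (cbox 0 (2 * pi)) (\<lambda>x. \<Phi> t (x, y)))" for t
    by (rule integral_swap_continuous)
       (simp add: case_prod_unfold, rule jointly_continuous_slice[OF c])
  thus ?thesis unfolding spacetime_integral_eq(2)[OF c]
    integral_torus_continuous(3)[OF jointly_continuous_slice[OF c]] by (simp add: 0)
qed

definition travelling_mode :: "int \<Rightarrow> real \<Rightarrow> real \<Rightarrow> real \<times> real \<Rightarrow> complex" where
  "travelling_mode n \<sigma> t z = cis (of_int n * (fst z - \<sigma> * t))"

lemma jointly_continuous_mode:
  assumes "smooth \<psi>"
  shows "jointly_continuous (\<lambda>t z. travelling_mode n \<sigma> t z * of_real (\<psi> t z))"
  using smoothD(4)[OF assms] unfolding jointly_continuous_def travelling_mode_def case_prod_unfold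
  by (intro continuous_intros)

text \<open>
  Integration by parts without boundary terms; the hypothesis on the endpoints holds by
  periodicity in space and by compact support in time.
\<close>

lemma integral_product_rule_zero:
  fixes f :: "real \<Rightarrow> complex"
  assumes "a \<le> b" "\<And>x. (f has_vector_derivative f' x) (at x within {a..b})"
    "\<And>x. (g has_vector_derivative g' x) (at x within {a..b})"
    "f a * of_real (g a) = f b * of_real (g b)"
  shows "integral {a..b} (\<lambda>x. f x * of_real (g' x) + f' x * of_real (g x)) = 0"
proof -
  have "((\<lambda>x. f x * of_real (g x)) has_vector_derivative (f x * of_real (g' x) + f' x * of_real (g x)))
      (at x within {a..b})" for x
    by (intro has_vector_derivative_mult has_vector_derivative_of_real assms(2)
          has_real_derivative_iff_has_vector_derivative[THEN iffD2, OF assms(3)])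
  from fundamental_theorem_of_calculus[OF assms(1) this] show ?thesis
    using assms(4) by (simp add: integral_unique)
qed

lemma has_vector_derivative_cis:
  "((\<lambda>x. cis (a * x + b)) has_vector_derivative \<i> * of_real a * cis (a * x + b)) (at x within A)"
  unfolding has_vector_derivative_complex_iff
  by (auto intro!: derivative_eq_intros)

text \<open>
  A derivative on the test function is replaced by the corresponding eigenvalue of the mode, with
  the opposite sign: the mode is an eigenfunction of \<open>\<partial>\<^sub>t\<close>, \<open>\<partial>\<^sub>x\<close> and \<open>\<partial>\<^sub>y\<close> with eigenvalues
  \<open>-\<i>n\<sigma>\<close>, \<open>\<i>n\<close> and \<open>0\<close>.
\<close>

context
  fixes \<psi> :: "real \<Rightarrow> real \<times> real \<Rightarrow> real" and n :: int and \<sigma> :: real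
  assumes smooth: "smooth \<psi>"
begin

lemma travelling_mode_Dt:
  assumes "\<And>z. \<psi> 0 z = 0" "\<And>z. \<psi> 1 z = 0"
  shows "spacetime_integral (\<lambda>t z. travelling_mode n \<sigma> t z * of_real (Dt \<psi> t z)) =
     \<i> * of_int n * of_real \<sigma> * spacetime_integral (\<lambda>t z. travelling_mode n \<sigma> t z * of_real (\<psi> t z))"
proof -
  have zero: "integral {0..1} (\<lambda>t. travelling_mode n \<sigma> t z * of_real (Dt \<psi> t z) +
      \<i> * of_real (- (of_int n * \<sigma>)) * travelling_mode n \<sigma> t z * of_real (\<psi> t z)) = 0" for z
  proof (rule integral_product_rule_zero)
    show "((\<lambda>t. travelling_mode n \<sigma> t z) has_vector_derivative
        \<i> * of_real (- (of_int n * \<sigma>)) * travelling_mode n \<sigma> t z) (at t within {0..1})" for t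
      using has_vector_derivative_cis[of "- (of_int n * \<sigma>)" "of_int n * fst z" t]
      unfolding travelling_mode_def by (simp add: algebra_simps)
    show "((\<lambda>t. \<psi> t z) has_vector_derivative Dt \<psi> t z) (at t within {0..1})" for t
      using smoothD(5)[OF smooth, of "fst z" "snd z"] by simp
  qed (simp_all add: assms)
  have "spacetime_integral (\<lambda>t z. travelling_mode n \<sigma> t z * of_real (Dt \<psi> t z) +
      (\<i> * of_real (- (of_int n * \<sigma>))) * (travelling_mode n \<sigma> t z * of_real (\<psi> t z))) = 0"
  proof (rule spacetime_integral_zero_t, goal_cases)
    case 1
    show ?case
      by (intro jointly_continuous_add jointly_continuous_cmult jointly_continuous_mode smooth smoothD(1))
  next
    case (2 z)
    show ?case using zero[of z] by (simp add: mult.assoc)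
  qed
  thus ?thesis
    unfolding spacetime_integral_add[OF jointly_continuous_mode[OF smoothD(1)[OF smooth]]
        jointly_continuous_cmult[OF jointly_continuous_mode[OF smooth]]] spacetime_integral_cmult
    by (simp add: add_eq_0_iff)
qed

lemma travelling_mode_Dx:
  assumes "\<And>t. torus_periodic (\<psi> t)"
  shows "spacetime_integral (\<lambda>t z. travelling_mode n \<sigma> t z * of_real (Dx \<psi> t z)) =
     - \<i> * of_int n * spacetime_integral (\<lambda>t z. travelling_mode n \<sigma> t z * of_real (\<psi> t z))"
proof -
  have zero: "integral {0..2 * pi} (\<lambda>x. travelling_mode n \<sigma> t (x, y) * of_real (Dx \<psi> t (x, y)) +
      \<i> * of_real (of_int n) * travelling_mode n \<sigma> t (x, y) * of_real (\<psi> t (x, y))) = 0" for t y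
  proof (rule integral_product_rule_zero)
    show "((\<lambda>x. travelling_mode n \<sigma> t (x, y)) has_vector_derivative
        \<i> * of_real (of_int n) * travelling_mode n \<sigma> t (x, y)) (at x within {0..2 * pi})" for x
      using has_vector_derivative_cis[of "of_int n" "- (of_int n * \<sigma> * t)" x]
      unfolding travelling_mode_def by (simp add: algebra_simps)
    show "((\<lambda>x. \<psi> t (x, y)) has_vector_derivative Dx \<psi> t (x, y)) (at x within {0..2 * pi})" for x
      by (rule smoothD(6)[OF smooth])
    have "travelling_mode n \<sigma> t (2 * pi, y) = travelling_mode n \<sigma> t (0, y) * cis (2 * pi * of_int n)"
      by (simp add: travelling_mode_def cis_mult algebra_simps)
    moreover have "\<psi> t (0 + 2 * pi, y) = \<psi> t (0, y)"
      using assms unfolding torus_periodic_def by blast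
    ultimately show "travelling_mode n \<sigma> t (0, y) * of_real (\<psi> t (0, y)) =
        travelling_mode n \<sigma> t (2 * pi, y) * of_real (\<psi> t (2 * pi, y))" by simp
  qed simp
  have "spacetime_integral (\<lambda>t z. travelling_mode n \<sigma> t z * of_real (Dx \<psi> t z) +
      (\<i> * of_int n) * (travelling_mode n \<sigma> t z * of_real (\<psi> t z))) = 0"
  proof (rule spacetime_integral_zero_x, goal_cases)
    case 1
    show ?case
      by (intro jointly_continuous_add jointly_continuous_cmult jointly_continuous_mode smooth smoothD(2))
  next
    case (2 t y)
    show ?case using zero[of t y] by (simp add: mult.assoc)
  qed
  thus ?thesis
    unfolding spacetime_integral_add[OF jointly_continuous_mode[OF smoothD(2)[OF smooth]]
        jointly_continuous_cmult[OF jointly_continuous_mode[OF smooth]]] spacetime_integral_cmult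
    by (simp add: add_eq_0_iff)
qed

lemma travelling_mode_Dy:
  assumes "\<And>t. torus_periodic (\<psi> t)"
  shows "spacetime_integral (\<lambda>t z. travelling_mode n \<sigma> t z * of_real (Dy \<psi> t z)) = 0"
proof (rule spacetime_integral_zero_y)
  fix t x
  have "integral {0..2 * pi} (\<lambda>y. travelling_mode n \<sigma> t (x, 0) * of_real (Dy \<psi> t (x, y)) +
      0 * of_real (\<psi> t (x, y))) = 0"
  proof (rule integral_product_rule_zero)
    show "((\<lambda>y. \<psi> t (x, y)) has_vector_derivative Dy \<psi> t (x, y)) (at y within {0..2 * pi})" for y
      by (rule smoothD(7)[OF smooth])
    have "\<psi> t (x, 0 + 2 * pi) = \<psi> t (x, 0)"
      using assms unfolding torus_periodic_def by blast
    thus "travelling_mode n \<sigma> t (x, 0) * of_real (\<psi> t (x, 0)) =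
        travelling_mode n \<sigma> t (x, 0) * of_real (\<psi> t (x, 2 * pi))" by simp
  qed (auto intro: derivative_eq_intros)
  thus "integral {0..2 * pi} (\<lambda>y. travelling_mode n \<sigma> t (x, y) * of_real (Dy \<psi> t (x, y))) = 0"
    by (simp add: travelling_mode_def)
qed (rule jointly_continuous_mode[OF smoothD(3)[OF smooth]])

end

lemma spacetime_integral_has_sum:
  assumes f: "\<And>k. jointly_continuous (f k)"
    and b: "\<And>k t z. t \<in> {0..1} \<Longrightarrow> z \<in> torus_square \<Longrightarrow> norm (f k t z) \<le> B k"
    and B: "B summable_on UNIV"
    and F: "\<And>t z. t \<in> {0..1} \<Longrightarrow> z \<in> torus_square \<Longrightarrow> ((\<lambda>k. f k t z) has_sum F t z) UNIV"
  shows "((\<lambda>k::int. spacetime_integral (f k)) has_sum spacetime_integral F) UNIV"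
proof -
  let ?A = "(2 * pi)\<^sup>2"
  have int: "integrable torus (f k t)" for k t
    by (intro integral_torus_continuous(1) jointly_continuous_slice f)
  have one: "integrable torus (\<lambda>_. 1 :: real)"
    using finite_measure.integrable_const[OF finite_measure_torus] .
  have 1: "((\<lambda>k. integral\<^sup>L torus (f k t)) has_sum integral\<^sup>L torus (F t)) UNIV" if "t \<in> {0..1}" for t
    by (rule has_sum_integral[where B = B and h = "\<lambda>_. 1", OF int one])
       (use that b B F in \<open>auto simp: space_torus\<close>)
  have 2: "norm (integral\<^sup>L torus (f k t)) \<le> ?A * B k" if "t \<in> {0..1}" for k t
  proof -
    have "norm (integral\<^sup>L torus (f k t)) \<le> (\<integral>z. norm (f k t z) \<partial>torus)" by (rule integral_norm_bound)
    also have "\<dots> \<le> (\<integral>z. B k \<partial>torus)"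
      by (rule integral_mono) (use int b[OF that] one in \<open>auto simp: space_torus finite_measure.integrable_const[OF finite_measure_torus]\<close>)
    finally show ?thesis by (simp add: measure_torus)
  qed
  have "((\<lambda>k. \<integral>t. indicator {0..1} t *\<^sub>R integral\<^sup>L torus (f k t) \<partial>lborel) has_sum
      (\<integral>t. indicator {0..1} t *\<^sub>R integral\<^sup>L torus (F t) \<partial>lborel)) UNIV"
  proof (rule has_sum_integral[where B = "\<lambda>k. ?A * B k" and h = "indicator {0..1}"])
    show "integrable lborel (\<lambda>t. indicator {0..1} t *\<^sub>R integral\<^sup>L torus (f k t))" for k
      using borel_integrable_atLeastAtMost'[OF spacetime_integral_eq(1)[OF f]]
      by (simp add: set_integrable_def)
    show "integrable lborel (indicator {0..1::real} :: real \<Rightarrow> real)" by simp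
    show "norm (indicator {0..1} t *\<^sub>R integral\<^sup>L torus (f k t)) \<le> ?A * B k * indicator {0..1} t" for k t
      using 2[of t k] by (auto simp: indicator_def)
    show "(\<lambda>k. ?A * B k) summable_on UNIV" by (intro summable_on_cmult_right B)
    show "((\<lambda>k. indicator {0..1} t *\<^sub>R integral\<^sup>L torus (f k t)) has_sum
        indicator {0..1} t *\<^sub>R integral\<^sup>L torus (F t)) UNIV" for t :: real
      using 1[of t] by (auto simp: indicator_def)
  qed
  thus ?thesis
    unfolding spacetime_integral_def set_integral_torus unfolding set_lebesgue_integral_def .
qed

lemma smooth_bounded:
  assumes "smooth \<psi>"
  obtains M where "M \<ge> 0" "\<And>t z. t \<in> {0..1} \<Longrightarrow> z \<in> torus_square \<Longrightarrow> \<bar>\<psi> t z\<bar> \<le> M"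
proof -
  have "compact ((\<lambda>(t, z). \<psi> t z) ` ({0..1} \<times> torus_square))"
    by (intro compact_continuous_image continuous_on_subset[OF smoothD(4)[OF assms]] compact_Times compact_torus_square) auto
  then obtain M where "\<And>x. x \<in> (\<lambda>(t, z). \<psi> t z) ` ({0..1} \<times> torus_square) \<Longrightarrow> norm x \<le> M"
    using compact_imp_bounded bounded_iff by metis
  thus ?thesis by (intro that[of "\<bar>M\<bar>"]) force+
qed

text \<open>
  The reduction of the equation to algebra. If \<open>w\<close> and \<open>w\<^sup>2/2\<close> have the coefficients \<open>C\<close> and \<open>D\<close>
  along the modes of frequency \<open>n = N k\<close>, then integration by parts turns the \<open>k\<close>-th term of the weak
  equation into \<open>\<i>n((n\<^sup>2 + \<sigma>)C\<^sub>k - D\<^sub>k)\<close> times the pairing of the mode with the test function. The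
  factor \<open>n\<close> leaves the coefficients at \<open>k = 0\<close> unconstrained. No derivative of \<open>w\<close> is formed, so
  absolute summability of \<open>C\<close> and \<open>D\<close> suffices.
\<close>

lemma ZK_distributional_travelling:
  fixes C D :: "int \<Rightarrow> complex"
  assumes C: "(\<lambda>k. norm (C k)) summable_on UNIV" and D: "(\<lambda>k. norm (D k)) summable_on UNIV"
    and w: "\<And>t z. ((\<lambda>k. C k * travelling_mode (N * k) \<sigma> t z) has_sum of_real (w t z)) UNIV"
    and w2: "\<And>t z. ((\<lambda>k. D k * travelling_mode (N * k) \<sigma> t z) has_sum of_real ((w t z)\<^sup>2 / 2)) UNIV"
    and CD: "\<And>k. k \<noteq> 0 \<Longrightarrow> D k = (of_int (N * k) ^ 2 + of_real \<sigma>) * C k"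
  shows "ZK_distributional w"
  unfolding ZK_distributional_def
proof (intro allI impI)
  fix \<psi> assume "test_function \<psi>"
  then obtain a b where sm: "smooth \<psi>" and per: "\<And>t. torus_periodic (\<psi> t)"
    and ab: "0 < a" "b < 1" "\<And>t z. t \<notin> {a..b} \<Longrightarrow> \<psi> t z = 0"
    unfolding test_function_def smooth_def by blast
  have bd: "\<psi> 0 z = 0" "\<psi> 1 z = 0" for z using ab by auto
  note pers = torus_periodic_derivatives
  note smx = smoothD(2)[OF sm] smoothD(2)[OF smoothD(2)[OF sm]] smoothD(2)[OF smoothD(2)[OF smoothD(2)[OF sm]]]
  note smy = smoothD(3)[OF sm] smoothD(3)[OF smoothD(3)[OF sm]] smoothD(2)[OF smoothD(3)[OF smoothD(3)[OF sm]]]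
  note smt = smoothD(1)[OF sm]
  define P where "P t z = Dt \<psi> t z + Dx (Dx (Dx \<psi>)) t z + Dx (Dy (Dy \<psi>)) t z" for t z
  define e where "e k = travelling_mode (N * k) \<sigma>" for k
  define f where "f k t z = C k * (e k t z * of_real (P t z)) + D k * (e k t z * of_real (Dx \<psi> t z))" for k t z
  have cD: "jointly_continuous (\<lambda>t z. e k t z * of_real (Dx \<psi> t z))" for k
    unfolding e_def by (rule jointly_continuous_mode[OF smx(1)])
  have c3: "jointly_continuous (\<lambda>t z. e k t z * of_real (Dt \<psi> t z))"
    "jointly_continuous (\<lambda>t z. e k t z * of_real (Dx (Dx (Dx \<psi>)) t z))"
    "jointly_continuous (\<lambda>t z. e k t z * of_real (Dx (Dy (Dy \<psi>)) t z))" for k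
    unfolding e_def by (intro jointly_continuous_mode smt smx smy)+
  have eP: "(\<lambda>t z. e k t z * of_real (P t z)) = (\<lambda>t z. e k t z * of_real (Dt \<psi> t z) +
      e k t z * of_real (Dx (Dx (Dx \<psi>)) t z) + e k t z * of_real (Dx (Dy (Dy \<psi>)) t z))" for k
    by (simp add: P_def distrib_left)
  note eP' = arg_cong[of _ _ spacetime_integral, OF eP]
  have c2: "jointly_continuous (\<lambda>t z. e k t z * of_real (Dt \<psi> t z) + e k t z * of_real (Dx (Dx (Dx \<psi>)) t z))" for k
    by (intro jointly_continuous_add c3)
  have cP: "jointly_continuous (\<lambda>t z. e k t z * of_real (P t z))" for k
    unfolding eP by (intro jointly_continuous_add c3)
  have cc: "jointly_continuous (\<lambda>t z. C k * (e k t z * of_real (P t z)))"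
     "jointly_continuous (\<lambda>t z. D k * (e k t z * of_real (Dx \<psi> t z)))" for k
    by (intro jointly_continuous_cmult cP cD)+
  have zero: "spacetime_integral (f k) = 0" for k
  proof -
    define S where "S = spacetime_integral (\<lambda>t z. e k t z * of_real (\<psi> t z))"
    define n where "n = N * k"
    have x1: "spacetime_integral (\<lambda>t z. e k t z * of_real (Dx \<psi> t z)) = - \<i> * of_int n * S"
      unfolding S_def e_def n_def by (rule travelling_mode_Dx[OF sm per])
    have x2: "spacetime_integral (\<lambda>t z. e k t z * of_real (Dx (Dx \<psi>) t z)) = - \<i> * of_int n * (- \<i> * of_int n * S)"
      unfolding x1[symmetric] unfolding e_def n_def by (rule travelling_mode_Dx[OF smx(1) pers(1)[OF per]])
    have x3: "spacetime_integral (\<lambda>t z. e k t z * of_real (Dx (Dx (Dx \<psi>)) t z)) = - \<i> * of_int n * (- \<i> * of_int n * (- \<i> * of_int n * S))"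
      unfolding x2[symmetric] unfolding e_def n_def by (rule travelling_mode_Dx[OF smx(2) pers(1)[OF pers(1)[OF per]]])
    have y: "spacetime_integral (\<lambda>t z. e k t z * of_real (Dx (Dy (Dy \<psi>)) t z)) = 0"
      unfolding e_def travelling_mode_Dx[OF smy(2) pers(2)[OF pers(2)[OF per]]]
        travelling_mode_Dy[OF smy(1) pers(2)[OF per]] by simp
    have t: "spacetime_integral (\<lambda>t z. e k t z * of_real (Dt \<psi> t z)) = \<i> * of_int n * of_real \<sigma> * S"
      unfolding S_def e_def n_def by (rule travelling_mode_Dt[OF sm bd])
    have "spacetime_integral (f k) = C k * (\<i> * of_int n * of_real \<sigma> * S + - \<i> * of_int n * (- \<i> * of_int n * (- \<i> * of_int n * S)))
        + D k * (- \<i> * of_int n * S)"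
      unfolding f_def spacetime_integral_add[OF cc] spacetime_integral_cmult eP'
        spacetime_integral_add[OF c2 c3(3)] spacetime_integral_add[OF c3(1,2)] x1 x3 y t by simp
    also have "\<dots> = \<i> * of_int n * S * ((of_int n ^ 2 + of_real \<sigma>) * C k - D k)"
      by (simp add: algebra_simps power2_eq_square)
    also have "\<dots> = 0"
      using CD[of k] by (cases "k = 0") (auto simp: n_def)
    finally show ?thesis .
  qed
  obtain M1 where M1: "M1 \<ge> 0" "\<And>t z. t \<in> {0..1} \<Longrightarrow> z \<in> torus_square \<Longrightarrow> \<bar>Dt \<psi> t z\<bar> \<le> M1"
    by (rule smooth_bounded[OF smt]) blast
  obtain M2 where M2: "M2 \<ge> 0" "\<And>t z. t \<in> {0..1} \<Longrightarrow> z \<in> torus_square \<Longrightarrow> \<bar>Dx (Dx (Dx \<psi>)) t z\<bar> \<le> M2"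
    by (rule smooth_bounded[OF smx(3)]) blast
  obtain M3 where M3: "M3 \<ge> 0" "\<And>t z. t \<in> {0..1} \<Longrightarrow> z \<in> torus_square \<Longrightarrow> \<bar>Dx (Dy (Dy \<psi>)) t z\<bar> \<le> M3"
    by (rule smooth_bounded[OF smy(3)]) blast
  obtain M4 where M4: "M4 \<ge> 0" "\<And>t z. t \<in> {0..1} \<Longrightarrow> z \<in> torus_square \<Longrightarrow> \<bar>Dx \<psi> t z\<bar> \<le> M4"
    by (rule smooth_bounded[OF smx(1)]) blast
  have ne: "norm (e k t z) = 1" for k t z by (simp add: e_def travelling_mode_def)
  define F where "F t z = complex_of_real (w t z * P t z + (w t z)\<^sup>2 / 2 * Dx \<psi> t z)" for t z
  have "((\<lambda>k. spacetime_integral (f k)) has_sum spacetime_integral F) UNIV"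
  proof (rule spacetime_integral_has_sum[where B = "\<lambda>k. norm (C k) * (M1 + M2 + M3) + norm (D k) * M4"])
    show "jointly_continuous (f k)" for k
      unfolding f_def by (intro jointly_continuous_add cc)
    show "norm (f k t z) \<le> norm (C k) * (M1 + M2 + M3) + norm (D k) * M4"
      if tz: "t \<in> {0..1}" "z \<in> torus_square" for k t z
    proof -
      have "\<bar>P t z\<bar> \<le> M1 + M2 + M3" using M1(2)[OF tz] M2(2)[OF tz] M3(2)[OF tz] unfolding P_def by linarith
      moreover have "norm (f k t z) \<le> norm (C k) * \<bar>P t z\<bar> + norm (D k) * \<bar>Dx \<psi> t z\<bar>"
        unfolding f_def by (rule order_trans[OF norm_triangle_ineq]) (simp add: norm_mult ne)
      ultimately show ?thesis
        using M4(2)[OF tz] mult_left_mono[of "\<bar>P t z\<bar>" "M1 + M2 + M3" "norm (C k)"]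
          mult_left_mono[of "\<bar>Dx \<psi> t z\<bar>" M4 "norm (D k)"] by simp
    qed
    show "(\<lambda>k. norm (C k) * (M1 + M2 + M3) + norm (D k) * M4) summable_on UNIV"
      by (intro summable_on_add summable_on_cmult_left C D)
    show "((\<lambda>k. f k t z) has_sum F t z) UNIV" for t z
      using has_sum_add[OF has_sum_cmult_left[OF w[of t z], of "of_real (P t z)"]
          has_sum_cmult_left[OF w2[of t z], of "of_real (Dx \<psi> t z)"]]
      by (simp add: F_def f_def e_def mult.assoc)
  qed
  hence "spacetime_integral F = 0" by (simp add: zero has_sum_iff)
  moreover have "spacetime_integral F = of_real (LINT t:{0..1}|lborel. LINT z:torus_square|lborel.
        w t z * P t z + (w t z)\<^sup>2 / 2 * Dx \<psi> t z)"
    unfolding spacetime_integral_def F_def set_integral_complex_of_real ..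
  ultimately show "(LINT t:{0..1}|lborel. LINT z:torus_square|lborel.
        w t z * (Dt \<psi> t z + Dx (Dx (Dx \<psi>)) t z + Dx (Dy (Dy \<psi>)) t z)
        + (w t z)\<^sup>2 / 2 * Dx \<psi> t z) = 0"
    by (simp add: P_def)
qed

section \<open>The convolution identity of cnoidal waves\<close>

text \<open>
  Half of the exponential decay, \<open>r\<^bsup>n/2\<^esup>\<close>, absorbs the power of \<open>n\<close>.
\<close>

lemma summable_powr_times_power:
  fixes r :: real
  assumes "0 < r" "r < 1"
  shows "summable (\<lambda>n. real n powr p * r ^ n)"
proof -
  define b where "b = - ln r / 2"
  have b: "b > 0" using assms by (simp add: b_def)
  have r: "r ^ n = exp (- b * real n) * exp (- b) ^ n" for n
  proof -
    have "r ^ n = exp (real n * ln r)" using assms by (simp add: exp_of_nat_mult)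
    also have "real n * ln r = - b * real n + real n * (- b)" by (simp add: b_def field_simps)
    finally show ?thesis by (simp only: exp_add exp_of_nat_mult)
  qed
  have "((\<lambda>n. real n powr p * exp (- b * real n)) \<longlongrightarrow> 0) at_top"
    using b by real_asymp
  hence "\<forall>\<^sub>F n in at_top. real n powr p * exp (- b * real n) < 1"
    by (rule order_tendstoD) simp
  hence "\<forall>\<^sub>F n in at_top. norm (real n powr p * r ^ n) \<le> exp (- b) ^ n"
    by eventually_elim (simp add: r mult.assoc[symmetric] mult_left_le_one_le less_imp_le abs_mult)
  thus ?thesis
    by (rule summable_comparison_test_ev) (use b in \<open>simp add: summable_geometric_iff\<close>)
qed

lemma summable_on_int_powr_times_power:
  fixes r :: real
  assumes "0 < r" "r < 1"
  shows "(\<lambda>k::int. \<bar>of_int k\<bar> powr p * r ^ nat \<bar>k\<bar>) summable_on UNIV"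
proof -
  let ?f = "\<lambda>k::int. \<bar>of_int k\<bar> powr p * r ^ nat \<bar>k\<bar>"
  have nat: "(\<lambda>n. real n powr p * r ^ n) summable_on UNIV"
    using summable_powr_times_power[OF assms] assms
    by (intro summable_nonneg_imp_summable_on) auto
  have "?f summable_on range int"
    using nat by (subst summable_on_reindex) (auto simp: o_def)
  moreover have "?f summable_on range (\<lambda>n. - int n)"
    using nat by (subst summable_on_reindex) (auto simp: o_def inj_on_def)
  ultimately have "?f summable_on (range int \<union> range (\<lambda>n. - int n))"
    by (rule summable_on_union)
  moreover have "range int \<union> range (\<lambda>n. - int n) = UNIV"
  proof -
    have "k \<in> range int \<union> range (\<lambda>n. - int n)" for k :: int
      by (cases k rule: int_cases2) auto
    thus ?thesis by blast
  qed
  ultimately show ?thesis by simp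
qed

text \<open>
  Up to normalisation the Fourier coefficients of the cnoidal wave of nome \<open>exp (-a)\<close>, the
  Weierstrass function along a line halfway between its poles. Division by zero gives the value \<open>0\<close>
  at \<open>k = 0\<close>, which selects the wave of mean zero.
\<close>

definition cnoidal :: "real \<Rightarrow> int \<Rightarrow> real" where
  "cnoidal a k = of_int k / sinh (of_int k * a)"

text \<open>
  The hyperbolic cotangent minus its limit at infinity: an odd function of \<open>k\<close>, exponentially small,
  and \<open>0\<close> at \<open>k = 0\<close> by division by zero.
\<close>

definition coth_excess :: "real \<Rightarrow> int \<Rightarrow> real" where
  "coth_excess a k = cosh (of_int k * a) / sinh (of_int k * a) - sgn (of_int k)"

lemma cnoidal_minus: "cnoidal a (- k) = cnoidal a k"
  by (simp add: cnoidal_def)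

lemma coth_excess_minus: "coth_excess a (- k) = - coth_excess a k"
  by (simp add: coth_excess_def)

lemma sinh_lower_bound:
  fixes a :: real
  assumes a: "a > 0" and k: "k > 0"
  shows "exp a ^ k * (1 - exp (- 2 * a)) \<le> 2 * sinh (real k * a)"
proof -
  have "exp (- 2 * (real k * a)) \<le> exp (- 2 * a)" using a k by simp
  hence "exp (real k * a) * (1 - exp (- 2 * a)) \<le> exp (real k * a) * (1 - exp (- 2 * (real k * a)))"
    by (intro mult_left_mono) auto
  also have "\<dots> = 2 * sinh (real k * a)"
    by (simp add: sinh_field_def right_diff_distrib flip: exp_add)
  finally show ?thesis by (simp add: exp_of_nat_mult)
qed

lemma cnoidal_bound:
  fixes a :: real
  assumes a: "a > 0"
  shows "0 \<le> cnoidal a k" "cnoidal a k \<le> 2 / (1 - exp (- 2 * a)) * (\<bar>of_int k\<bar> * exp (- a) ^ nat \<bar>k\<bar>)"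
proof -
  have e: "1 - exp (- 2 * a) > 0" using a by simp
  have *: "0 \<le> cnoidal a (int n) \<and> cnoidal a (int n) \<le> 2 / (1 - exp (- 2 * a)) * (real n * exp (- a) ^ n)" for n
  proof (cases "n = 0")
    case False
    define E where "E = exp a ^ n"
    have E: "E > 0" by (simp add: E_def)
    have inv: "exp (- a) ^ n = 1 / E" by (simp add: E_def exp_minus power_inverse field_simps)
    have s: "E * (1 - exp (- 2 * a)) \<le> 2 * sinh (real n * a)"
      unfolding E_def using sinh_lower_bound[OF a, of n] False by simp
    have p: "E * (1 - exp (- 2 * a)) > 0" using E e by simp
    have "real n / sinh (real n * a) = 2 * real n / (2 * sinh (real n * a))" by simp
    also have "\<dots> \<le> 2 * real n / (E * (1 - exp (- 2 * a)))"
      by (rule divide_left_mono[OF s], use p s in simp, rule mult_pos_pos, use p s in linarith, rule p)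
    also have "\<dots> = 2 / (1 - exp (- 2 * a)) * (real n * exp (- a) ^ n)"
      unfolding inv by simp
    finally show ?thesis using a False by (simp add: cnoidal_def)
  qed (simp add: cnoidal_def)
  have "cnoidal a k = cnoidal a (int (nat \<bar>k\<bar>))"
    by (cases "k \<ge> 0") (simp_all add: cnoidal_minus)
  with *[of "nat \<bar>k\<bar>"] show "0 \<le> cnoidal a k"
    "cnoidal a k \<le> 2 / (1 - exp (- 2 * a)) * (\<bar>of_int k\<bar> * exp (- a) ^ nat \<bar>k\<bar>)" by simp_all
qed

lemma coth_excess_bound:
  fixes a :: real
  assumes a: "a > 0"
  shows "\<bar>coth_excess a k\<bar> \<le> 2 / (1 - exp (- 2 * a)) * exp (- a) ^ nat \<bar>k\<bar>"
proof -
  have e: "1 - exp (- 2 * a) > 0" using a by simp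
  have *: "\<bar>coth_excess a (int n)\<bar> \<le> 2 / (1 - exp (- 2 * a)) * exp (- a) ^ n" for n
  proof (cases "n = 0")
    case False
    define x where "x = real n * a"
    have x: "x > 0" using a False by (simp add: x_def)
    have E: "exp x > 0" "exp x \<ge> 1" using x by simp_all
    have s: "exp x * (1 - exp (- 2 * a)) \<le> 2 * sinh x"
      unfolding x_def using sinh_lower_bound[OF a, of n] False by (simp add: exp_of_nat_mult)
    have p: "exp x * (1 - exp (- 2 * a)) > 0" using E e by simp
    have "\<bar>coth_excess a (int n)\<bar> = 2 * exp (- x) / (2 * sinh x)"
    proof -
      have "coth_excess a (int n) = (cosh x - sinh x) / sinh x"
        using False x by (simp add: coth_excess_def x_def[symmetric] diff_divide_distrib)
      thus ?thesis using cosh_minus_sinh[of x] x by simp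
    qed
    also have "\<dots> \<le> 2 * exp (- x) / (exp x * (1 - exp (- 2 * a)))"
      by (rule divide_left_mono[OF s], use p s in simp, rule mult_pos_pos, use p s in linarith, rule p)
    also have "\<dots> \<le> 2 * exp (- x) / (1 * (1 - exp (- 2 * a)))"
      by (rule divide_left_mono, rule mult_right_mono, use e E in simp_all)
    also have "\<dots> = 2 / (1 - exp (- 2 * a)) * exp (- a) ^ n"
      by (simp add: x_def flip: exp_of_nat_mult)
    finally show ?thesis .
  qed (use e in \<open>simp add: coth_excess_def\<close>)
  have "\<bar>coth_excess a k\<bar> = \<bar>coth_excess a (int (nat \<bar>k\<bar>))\<bar>"
    by (cases "k \<ge> 0") (simp_all add: coth_excess_minus)
  with *[of "nat \<bar>k\<bar>"] show ?thesis by simp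
qed

lemma cnoidal_summable:
  assumes "a > 0" shows "(\<lambda>k. cnoidal a k) summable_on UNIV"
proof (rule summable_on_comparison_test)
  show "(\<lambda>k. 2 / (1 - exp (- 2 * a)) * (\<bar>of_int k\<bar> powr 1 * exp (- a) ^ nat \<bar>k\<bar>)) summable_on UNIV"
    using assms by (intro summable_on_cmult_right summable_on_int_powr_times_power) auto
qed (use cnoidal_bound[OF assms] in auto)

lemma coth_excess_moment_summable:
  assumes "a > 0" shows "(\<lambda>k. of_int k ^ p * coth_excess a k) summable_on UNIV"
proof (rule abs_summable_summable, rule summable_on_comparison_test)
  show "(\<lambda>k. 2 / (1 - exp (- 2 * a)) * (\<bar>of_int k\<bar> powr real (p + 1) * exp (- a) ^ nat \<bar>k\<bar>)) summable_on UNIV"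
    using assms by (intro summable_on_cmult_right summable_on_int_powr_times_power) auto
  fix k :: int
  show "norm (of_int k ^ p * coth_excess a k) \<le> 2 / (1 - exp (- 2 * a)) * (\<bar>of_int k\<bar> powr real (p + 1) * exp (- a) ^ nat \<bar>k\<bar>)"
  proof (cases "k = 0")
    case False
    hence k1: "\<bar>of_int k\<bar> \<ge> (1::real)" by linarith
    hence "\<bar>of_int k\<bar> ^ p \<le> \<bar>of_int k :: real\<bar> ^ (p + 1)" by (intro power_increasing) auto
    hence "\<bar>of_int k\<bar> ^ p \<le> \<bar>of_int k\<bar> powr real (p + 1)"
      using k1 by (subst powr_realpow) auto
    hence "\<bar>of_int k\<bar> ^ p * \<bar>coth_excess a k\<bar> \<le> \<bar>of_int k\<bar> powr real (p + 1) * (2 / (1 - exp (- 2 * a)) * exp (- a) ^ nat \<bar>k\<bar>)"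
      by (intro mult_mono coth_excess_bound assms) auto
    thus ?thesis by (simp add: abs_mult power_abs mult_ac)
  qed (simp add: coth_excess_def)
qed auto

text \<open>
  From \<open>1 / (sinh x sinh y) = (coth x + coth y) / sinh (x + y)\<close>, in which the hyperbolic cotangents
  are split into sign and excess. The identity also holds at \<open>j = 0\<close> and \<open>j = n\<close>, where all terms
  vanish.
\<close>

lemma cnoidal_product:
  fixes n j :: int
  assumes a: "a > 0"
  shows "sinh (of_int n * a) * (cnoidal a j * cnoidal a (n - j)) =
    of_int (j * (n - j)) * (sgn (of_int j) + sgn (of_int (n - j))) +
    of_int (j * (n - j)) * coth_excess a j + of_int (j * (n - j)) * coth_excess a (n - j)"
proof (cases "j = 0 \<or> n - j = 0")
  case True
  thus ?thesis by (auto simp: cnoidal_def)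
next
  case False
  define x where "x = of_int j * a"
  define y where "y = of_int (n - j) * a"
  have nz: "sinh x \<noteq> 0" "sinh y \<noteq> 0" using False a by (auto simp: x_def y_def)
  have "of_int n * a = x + y" by (simp add: x_def y_def algebra_simps)
  hence "sinh (of_int n * a) * (cnoidal a j * cnoidal a (n - j)) =
     of_int (j * (n - j)) * ((sinh x * cosh y + cosh x * sinh y) / (sinh x * sinh y))"
    by (simp add: cnoidal_def sinh_add x_def[symmetric] y_def[symmetric] del: of_int_diff)
  also have "(sinh x * cosh y + cosh x * sinh y) / (sinh x * sinh y) = cosh x / sinh x + cosh y / sinh y"
    using nz by (simp add: field_simps)
  finally show ?thesis
    by (simp add: coth_excess_def x_def[symmetric] y_def[symmetric] ring_distribs del: of_int_diff of_int_mult)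
qed

lemma sum_product_complement: "(\<Sum>j = 0..int m. j * (int m - j)) * 6 = int m ^ 3 - int m"
proof -
  have gen: "(\<Sum>j = 0..int m. j * (c - j)) * 6 = 3 * c * (int m * (int m + 1)) - int m * (int m + 1) * (2 * int m + 1)" for c
  proof (induction m)
    case (Suc m)
    have "{0..int (Suc m)} = insert (int (Suc m)) {0..int m}" by auto
    thus ?case using Suc by (simp add: algebra_simps)
  qed simp
  show ?thesis unfolding gen by (simp add: algebra_simps power3_eq_cube)
qed

text \<open>
  The two signs cancel outside \<open>{0..n}\<close>, so the sum over \<open>\<int>\<close> is the finite sum
  \<open>2 (\<Sum>j = 0..n. j (n - j))\<close>.
\<close>

lemma sgn_convolution:
  fixes n :: int
  assumes n: "n > 0"
  shows "((\<lambda>j. of_int (j * (n - j)) * (sgn (of_int j) + sgn (of_int (n - j))))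
     has_sum ((of_int n ^ 3 - of_int n) / 3 :: real)) UNIV"
proof (rule has_sum_finite_neutralI[where B = "{0..n}"])
  fix j assume "j \<in> UNIV - {0..n}"
  thus "of_int (j * (n - j)) * (sgn (of_int j) + sgn (of_int (n - j))) = (0::real)"
    using n by (auto simp: sgn_if)
next
  have "(\<Sum>j = 0..n. of_int (j * (n - j)) * (sgn (of_int j) + sgn (of_int (n - j))) :: real) =
      (\<Sum>j = 0..n. of_int (j * (n - j)) * 2)"
    by (intro sum.cong) (auto simp: sgn_if)
  also have "\<dots> = of_int (\<Sum>j = 0..n. j * (n - j)) * 2"
    by (simp add: sum_distrib_right)
  also have "\<dots> = of_int ((\<Sum>j = 0..n. j * (n - j)) * 6) / 3" by simp
  also have "(\<Sum>j = 0..n. j * (n - j)) * 6 = n ^ 3 - n"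
    using sum_product_complement[of "nat n"] n by simp
  finally show "(of_int n ^ 3 - of_int n) / 3 = (\<Sum>j = 0..n. of_int (j * (n - j)) * (sgn (of_int j) + sgn (of_int (n - j))) :: real)"
    by simp
qed auto

definition coth_moment :: "real \<Rightarrow> real" where
  "coth_moment a = (\<Sum>\<^sub>\<infinity>k. of_int k * coth_excess a k)"

text \<open>
  Expanding \<open>j (n - j)\<close> leaves the first moment alone, because the second moment of an odd function
  vanishes.
\<close>

lemma coth_excess_convolution:
  assumes a: "a > 0"
  shows "((\<lambda>j. of_int (j * (n - j)) * coth_excess a j) has_sum (of_int n * coth_moment a)) UNIV"
proof -
  define Q where "Q = (\<Sum>\<^sub>\<infinity>k. of_int k ^ 2 * coth_excess a k)"
  have "Q = (\<Sum>\<^sub>\<infinity>k. of_int (- k) ^ 2 * coth_excess a (- k))"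
    unfolding Q_def by (rule infsum_reindex_bij_betw[symmetric]) (rule bij_uminus)
  also have "\<dots> = - Q" by (simp add: Q_def coth_excess_minus infsum_uminus)
  finally have Q: "Q = 0" by simp
  have 1: "((\<lambda>k. of_int k * coth_excess a k) has_sum coth_moment a) UNIV"
    unfolding coth_moment_def using coth_excess_moment_summable[OF a, of 1] by (intro has_sum_infsum) simp
  have 2: "((\<lambda>k. of_int k ^ 2 * coth_excess a k) has_sum Q) UNIV"
    unfolding Q_def using coth_excess_moment_summable[OF a, of 2] by (rule has_sum_infsum)
  have "((\<lambda>k. of_int n * (of_int k * coth_excess a k) + - (of_int k ^ 2 * coth_excess a k)) has_sum
     (of_int n * coth_moment a + - Q)) UNIV"
    by (intro has_sum_add has_sum_cmult_right has_sum_uminusI 1 2)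
  thus ?thesis by (simp add: Q algebra_simps power2_eq_square)
qed

text \<open>
  This is the ordinary differential equation of the cnoidal wave on the Fourier side: convolution
  squares the profile, and the factor \<open>of_int n ^ 2\<close> is minus the second derivative. The case
  \<open>n = 0\<close> is excluded, since it only fixes the constant of integration.
\<close>

theorem cnoidal_convolution:
  assumes a: "a > 0" and n: "n \<noteq> 0"
  shows "((\<lambda>j. cnoidal a j * cnoidal a (n - j)) has_sum
     (cnoidal a n * ((of_int n ^ 2 - 1) / 3 + 2 * coth_moment a))) UNIV"
proof -
  have pos: "((\<lambda>j. cnoidal a j * cnoidal a (n - j)) has_sum
     (cnoidal a n * ((of_int n ^ 2 - 1) / 3 + 2 * coth_moment a))) UNIV" if n: "n > 0" for n :: int
  proof -
    have s: "sinh (of_int n * a) \<noteq> 0" using a n by simp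
    have "bij (\<lambda>j. n - j)" by (rule involuntory_imp_bij) simp
    from has_sum_reindex_bij_betw[OF this, of "\<lambda>j. of_int (j * (n - j)) * coth_excess a j"]
    have r: "((\<lambda>j. of_int (j * (n - j)) * coth_excess a (n - j)) has_sum (of_int n * coth_moment a)) UNIV"
      using coth_excess_convolution[OF a, of n] by (simp add: mult.commute)
    have "((\<lambda>j. sinh (of_int n * a) * (cnoidal a j * cnoidal a (n - j))) has_sum
       ((of_int n ^ 3 - of_int n) / 3 + of_int n * coth_moment a + of_int n * coth_moment a)) UNIV"
      unfolding cnoidal_product[OF a]
      by (intro has_sum_add sgn_convolution coth_excess_convolution r n a)
    hence "((\<lambda>j. (1 / sinh (of_int n * a)) * (sinh (of_int n * a) * (cnoidal a j * cnoidal a (n - j)))) has_sum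
       ((1 / sinh (of_int n * a)) * ((of_int n ^ 3 - of_int n) / 3 + of_int n * coth_moment a + of_int n * coth_moment a))) UNIV"
      by (rule has_sum_cmult_right)
    moreover have "(1 / sinh (of_int n * a)) * (sinh (of_int n * a) * x) = x" for x
      using s by simp
    moreover have "(1 / sinh (of_int n * a)) * ((of_int n ^ 3 - of_int n) / 3 + of_int n * coth_moment a + of_int n * coth_moment a)
        = cnoidal a n * ((of_int n ^ 2 - 1) / 3 + 2 * coth_moment a)"
      using s by (simp add: cnoidal_def field_simps power3_eq_cube power2_eq_square)
    ultimately show ?thesis by simp
  qed
  show ?thesis
  proof (cases "n > 0")
    case False
    hence "((\<lambda>j. cnoidal a j * cnoidal a (- n - j)) has_sum
     (cnoidal a n * ((of_int n ^ 2 - 1) / 3 + 2 * coth_moment a))) UNIV"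
      using pos[of "- n"] n by (simp add: cnoidal_minus)
    moreover have "((\<lambda>j. cnoidal a (- j) * cnoidal a (- n - (- j))) has_sum S) UNIV \<longleftrightarrow>
        ((\<lambda>j. cnoidal a j * cnoidal a (- n - j)) has_sum S) UNIV" for S
      by (rule has_sum_reindex_bij_betw) (rule bij_uminus)
    moreover have "cnoidal a (- j) * cnoidal a (- n - (- j)) = cnoidal a j * cnoidal a (n - j)" for j
      using cnoidal_minus[of a "n - j"] by (simp add: cnoidal_minus)
    ultimately show ?thesis by simp
  qed (rule pos)
qed

text \<open>
  The Cauchy product over \<open>\<int>\<close>: the double series is reindexed by \<open>n = j + k\<close>.
\<close>

lemma has_sum_convolution_square:
  fixes C :: "int \<Rightarrow> complex" and e :: "int \<Rightarrow> complex"
  assumes C: "(\<lambda>k. norm (C k)) summable_on UNIV"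
    and e: "\<And>k. norm (e k) = 1" "\<And>j k. e (j + k) = e j * e k"
    and w: "((\<lambda>k. C k * e k) has_sum w) UNIV"
  shows "(\<lambda>n. norm (\<Sum>\<^sub>\<infinity>j. C j * C (n - j))) summable_on UNIV"
    "((\<lambda>n. (\<Sum>\<^sub>\<infinity>j. C j * C (n - j)) * e n) has_sum w\<^sup>2) UNIV"
proof -
  have abs: "(\<lambda>k. norm (C k * e k)) summable_on UNIV" using C by (simp add: norm_mult e)
  define f where "f = (\<lambda>(j, k). (C j * e j) * (C k * e k))"
  have "(\<lambda>x. norm (f x)) summable_on UNIV \<times> UNIV"
    unfolding Infinite_Sum.abs_summable_on_Sigma_iff
  proof safe
    show "(\<lambda>k. norm (f (j, k))) summable_on UNIV" for j
      using summable_on_cmult_right[OF abs, of "norm (C j * e j)"] by (simp add: f_def norm_mult)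
    have "(\<lambda>j. norm (C j * e j) * (\<Sum>\<^sub>\<infinity>k. norm (C k * e k))) summable_on UNIV"
      by (rule summable_on_cmult_left[OF abs])
    thus "(\<lambda>j. norm (\<Sum>\<^sub>\<infinity>k. norm (f (j, k)))) summable_on UNIV"
      by (simp add: f_def norm_mult infsum_cmult_right' abs_mult infsum_nonneg)
  qed
  hence fa: "(\<lambda>x. norm (f x)) summable_on UNIV" by simp
  have "(f has_sum w * w) (UNIV \<times> UNIV)"
  proof (rule has_sum_SigmaI)
    show "((\<lambda>k. f (j, k)) has_sum (C j * e j) * w) UNIV" for j
      unfolding f_def by (simp, rule has_sum_cmult_right[OF w])
    show "((\<lambda>j. (C j * e j) * w) has_sum w * w) UNIV" by (rule has_sum_cmult_left[OF w])
    show "f summable_on UNIV \<times> UNIV" using abs_summable_summable[OF fa] by simp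
  qed
  hence fs: "(f has_sum w\<^sup>2) UNIV" by (simp add: power2_eq_square)
  have bij: "bij (\<lambda>(n, j). (j, n - j :: int))"
    by (rule o_bij[of "\<lambda>(j, k). (j + k, j)"]) (auto simp: fun_eq_iff)
  define g where "g = (\<lambda>(n, j). C j * C (n - j) * e n)"
  have g: "g x = f ((\<lambda>(n, j). (j, n - j)) x)" for x
    using e(2) by (auto simp: g_def f_def split: prod.split) (metis (no_types, lifting) add.commute diff_add_cancel mult.assoc mult.commute)
  have gs: "(g has_sum w\<^sup>2) (UNIV \<times> UNIV)"
    using fs has_sum_reindex_bij_betw[OF bij, of f] unfolding g[abs_def, symmetric] by simp
  have "(\<lambda>x. norm (g x)) summable_on UNIV \<times> UNIV"
    using fa summable_on_reindex_bij_betw[OF bij, of "\<lambda>x. norm (f x)"] unfolding g[symmetric] by simp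
  hence "\<forall>n\<in>UNIV. (\<lambda>j. norm (g (n, j))) summable_on UNIV"
    "(\<lambda>n. norm (\<Sum>\<^sub>\<infinity>j. norm (g (n, j)))) summable_on UNIV"
    unfolding Infinite_Sum.abs_summable_on_Sigma_iff by blast+
  hence gn: "(\<lambda>j. norm (C j * C (n - j))) summable_on UNIV"
    and gg: "(\<lambda>n. \<Sum>\<^sub>\<infinity>j. norm (C j * C (n - j))) summable_on UNIV" for n
    by (simp_all add: g_def norm_mult e infsum_nonneg)
  show "(\<lambda>n. norm (\<Sum>\<^sub>\<infinity>j. C j * C (n - j))) summable_on UNIV"
    by (rule summable_on_comparison_test[OF gg]) (auto intro: norm_infsum_bound gn)
  show "((\<lambda>n. (\<Sum>\<^sub>\<infinity>j. C j * C (n - j)) * e n) has_sum w\<^sup>2) UNIV"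
  proof (rule has_sum_SigmaD[OF gs])
    show "((\<lambda>j. g (n, j)) has_sum (\<Sum>\<^sub>\<infinity>j. C j * C (n - j)) * e n) UNIV" for n
      unfolding g_def by (simp, intro has_sum_cmult_left has_sum_infsum) (rule abs_summable_summable[OF gn])
  qed
qed

section \<open>Two families of cnoidal waves that drift apart\<close>

text \<open>
  The amplitude \<open>6 N\<^sup>2\<close> is the one for which the quadratic term balances the dispersion at wave number
  \<open>N\<close>; \<open>d\<close> is the mean of the wave. By Galilean invariance the mean is added to the speed.
\<close>

definition profile :: "real \<Rightarrow> int \<Rightarrow> real \<Rightarrow> int \<Rightarrow> real" where
  "profile a N d k = 6 * of_int N ^ 2 * cnoidal a k + (if k = 0 then d else 0)"

definition speed :: "real \<Rightarrow> int \<Rightarrow> real \<Rightarrow> real" where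
  "speed a N d = of_int N ^ 2 * (6 * coth_moment a - 1) + d"

definition wave_coeffs :: "real \<Rightarrow> int \<Rightarrow> real \<Rightarrow> real \<Rightarrow> int \<Rightarrow> complex" where
  "wave_coeffs a N d t k = of_real (profile a N d k) * cis (- (of_int (N * k) * (speed a N d * t)))"

definition cnoidal_wave :: "real \<Rightarrow> int \<Rightarrow> real \<Rightarrow> real \<Rightarrow> real \<times> real \<Rightarrow> real" where
  "cnoidal_wave a N d t = wave N (wave_coeffs a N d t)"

lemma cnoidal_0 [simp]: "cnoidal a 0 = 0"
  by (simp add: cnoidal_def)

text \<open>
  The mean \<open>d\<close> contributes the two cross terms \<open>j = 0\<close> and \<open>j = k\<close>, which together raise the speed
  by exactly \<open>d\<close>.
\<close>

lemma profile_convolution: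
  assumes a: "a > 0" and k: "k \<noteq> 0"
  shows "((\<lambda>j. profile a N d j * profile a N d (k - j)) has_sum
     (2 * (of_int (N * k) ^ 2 + speed a N d) * profile a N d k)) UNIV"
proof -
  define B where "B = 6 * of_int N ^ 2 * cnoidal a k"
  define S where "S = cnoidal a k * ((of_int k ^ 2 - 1) / 3 + 2 * coth_moment a)"
  have 1: "((\<lambda>j. 36 * of_int N ^ 4 * (cnoidal a j * cnoidal a (k - j))) has_sum (36 * of_int N ^ 4 * S)) UNIV"
    unfolding S_def by (intro has_sum_cmult_right cnoidal_convolution a k)
  have 2: "((\<lambda>j. if j = 0 then d * B else 0) has_sum (d * B)) UNIV"
    by (rule has_sum_finite_neutralI[of "{0}"]) auto
  have 3: "((\<lambda>j. if j = k then d * B else 0) has_sum (d * B)) UNIV"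
    by (rule has_sum_finite_neutralI[of "{k}"]) auto
  have eq: "profile a N d j * profile a N d (k - j) = 36 * of_int N ^ 4 * (cnoidal a j * cnoidal a (k - j)) +
      (if j = 0 then d * B else 0) + (if j = k then d * B else 0)" for j
    using k by (simp add: profile_def B_def eval_nat_numeral)
  have val: "36 * of_int N ^ 4 * S + d * B + d * B = 2 * (of_int (N * k) ^ 2 + speed a N d) * profile a N d k"
    using k by (simp add: S_def B_def profile_def speed_def field_simps eval_nat_numeral)
  show ?thesis unfolding eq val[symmetric] by (intro has_sum_add 1 2 3)
qed

lemma profile_summable:
  assumes "a > 0"
  shows "(\<lambda>k. norm (complex_of_real (profile a N d k))) summable_on UNIV"
proof (rule summable_on_comparison_test)
  show "(\<lambda>k. 6 * of_int N ^ 2 * cnoidal a k + (if k = 0 then \<bar>d\<bar> else 0)) summable_on UNIV"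
    by (intro summable_on_add summable_on_cmult_right cnoidal_summable assms
          finite_nonzero_values_imp_summable_on) auto
  show "norm (complex_of_real (profile a N d k)) \<le> 6 * of_int N ^ 2 * cnoidal a k + (if k = 0 then \<bar>d\<bar> else 0)" for k
    unfolding norm_of_real using cnoidal_bound(1)[OF assms, of k] by (simp add: profile_def)
qed auto

lemma wave_coeffs_hermitian: "hermitian (wave_coeffs a N d t)"
  by (simp add: hermitian_def wave_coeffs_def profile_def cnoidal_minus cis_cnj)

lemma norm_wave_coeffs: "norm (wave_coeffs a N d t k) = \<bar>profile a N d k\<bar>"
  by (simp add: wave_coeffs_def norm_mult)

lemma cnoidal_wave_modes:
  assumes "a > 0"
  shows "((\<lambda>k. of_real (profile a N d k) * travelling_mode (N * k) (speed a N d) t z) has_sum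
     of_real (cnoidal_wave a N d t z)) UNIV"
proof -
  have "((\<lambda>k. wave_coeffs a N d t k * character (N * k, 0) z) has_sum of_real (cnoidal_wave a N d t z)) UNIV"
    unfolding cnoidal_wave_def
    by (rule has_sum_wave) (use profile_summable[OF assms] in \<open>simp_all add: norm_wave_coeffs wave_coeffs_hermitian\<close>)
  moreover have "wave_coeffs a N d t k * character (N * k, 0) z =
      of_real (profile a N d k) * travelling_mode (N * k) (speed a N d) t z" for k
    by (simp add: wave_coeffs_def travelling_mode_def character_def cis_mult mult.assoc algebra_simps)
  ultimately show ?thesis by simp
qed

lemma travelling_mode_add: "travelling_mode (m + n) \<sigma> t z = travelling_mode m \<sigma> t z * travelling_mode n \<sigma> t z"
  by (simp add: travelling_mode_def cis_mult algebra_simps)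

lemma ZK_distributional_cnoidal_wave:
  assumes a: "a > 0"
  shows "ZK_distributional (cnoidal_wave a N d)"
proof -
  define P where "P k = complex_of_real (profile a N d k)" for k
  define D where "D k = (\<Sum>\<^sub>\<infinity>j. P j * P (k - j)) / 2" for k
  have P: "(\<lambda>k. norm (P k)) summable_on UNIV" unfolding P_def by (rule profile_summable[OF a])
  note w = cnoidal_wave_modes[OF a, of N d, folded P_def]
  note sq = has_sum_convolution_square[OF P _ _ w]
  have e: "norm (travelling_mode n \<sigma> t z) = 1" for n \<sigma> t z by (simp add: travelling_mode_def)
  have e2: "travelling_mode (N * (j + k)) \<sigma> t z = travelling_mode (N * j) \<sigma> t z * travelling_mode (N * k) \<sigma> t z"
    for j k \<sigma> t z by (simp add: travelling_mode_add distrib_left)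
  show ?thesis
  proof (rule ZK_distributional_travelling[where C = P and D = D])
    show "(\<lambda>k. norm (P k)) summable_on UNIV" by (rule P)
    show "(\<lambda>k. norm (D k)) summable_on UNIV"
      using summable_on_cmult_left[OF sq(1)[OF e e2], of "1/2"] by (simp add: D_def norm_divide)
    show "((\<lambda>k. P k * travelling_mode (N * k) (speed a N d) t z) has_sum of_real (cnoidal_wave a N d t z)) UNIV" for t z
      by (rule w)
    show "((\<lambda>k. D k * travelling_mode (N * k) (speed a N d) t z) has_sum
        of_real ((cnoidal_wave a N d t z)\<^sup>2 / 2)) UNIV" for t z
      using has_sum_cmult_left[OF has_sum_convolution_square(2)[OF P e e2 w[of t z]], of "1/2"] by (simp add: D_def)
    show "D k = (of_int (N * k) ^ 2 + of_real (speed a N d)) * P k" if k: "k \<noteq> 0" for k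
    proof -
      have "((\<lambda>j. complex_of_real (profile a N d j * profile a N d (k - j))) has_sum
          complex_of_real (2 * (of_int (N * k) ^ 2 + speed a N d) * profile a N d k)) UNIV"
        by (rule has_sum_of_real) (rule profile_convolution[OF a k])
      thus ?thesis by (simp add: D_def P_def infsumI)
    qed
  qed
qed

text \<open>
  The power of \<open>N\<close> compensates the factor \<open>N\<^sup>2\<close> of the amplitude and the factor \<open>N\<^sup>s\<close> of the
  Sobolev weight, so that the \<open>H\<^sup>s\<close> norm of the wave stays bounded above and below as \<open>N\<close> grows. The
  factor \<open>1 / 2\<close> keeps the nome away from \<open>1\<close> when \<open>N = 1\<close>.
\<close>

definition nome :: "real \<Rightarrow> int \<Rightarrow> real" where
  "nome s N = of_int N powr (- (s + 2)) / 2"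

definition decay_rate :: "real \<Rightarrow> int \<Rightarrow> real" where
  "decay_rate s N = - ln (nome s N)"

text \<open>
  A summable bound, uniform in \<open>N\<close>, of the weighted coefficients of nonzero frequency.
\<close>

definition majorant :: "real \<Rightarrow> int \<Rightarrow> real" where
  "majorant s k = 16 * 2 powr (s / 2) * (\<bar>of_int k\<bar> powr (s + 1) * (1 / 2) ^ nat \<bar>k\<bar>)"

lemma majorant_summable: "majorant s summable_on UNIV"
  unfolding majorant_def by (intro summable_on_cmult_right summable_on_int_powr_times_power) auto

lemma majorant_nonneg: "majorant s k \<ge> 0"
  by (simp add: majorant_def)

lemma nome_bounds:
  assumes "N \<ge> 1" "s \<ge> 0"
  shows "0 < nome s N" "nome s N \<le> 1 / 2" "exp (- decay_rate s N) = nome s N" "decay_rate s N > 0"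
proof -
  have "of_int N powr (- (s + 2)) \<le> (of_int N :: real) powr 0"
    using assms by (intro powr_mono) auto
  thus 1: "0 < nome s N" "nome s N \<le> 1 / 2" using assms by (auto simp: nome_def)
  thus "exp (- decay_rate s N) = nome s N" "decay_rate s N > 0" by (simp_all add: decay_rate_def)
qed

lemma powr_scaling_cancel: "(x :: real) > 0 \<Longrightarrow> x powr s * x powr 2 * x powr (- (s + 2)) = 1"
  unfolding powr_add[symmetric] by simp

text \<open>
  For \<open>k \<noteq> 0\<close> the weight is at most \<open>2\<^bsup>s/2\<^esup> N\<^sup>s \<bar>k\<bar>\<^sup>s\<close> and the coefficient at most \<open>16 N\<^sup>2 \<bar>k\<bar> q\<^bsup>\<bar>k\<bar>\<^esup>\<close> with
  \<open>q\<close> the nome. Only one factor \<open>N\<^bsup>-(s+2)\<^esup>\<close> of \<open>q\<^bsup>\<bar>k\<bar>\<^esup>\<close> is needed to cancel the powers of \<open>N\<close>; the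
  factors \<open>1 / 2\<close> give the decay in \<open>k\<close>.
\<close>

lemma weight_profile_le_majorant:
  assumes N: "N \<ge> 1" and s: "s \<ge> 0"
  shows "weight s N k * (6 * of_int N ^ 2 * cnoidal (decay_rate s N) k) \<le> majorant s k"
proof (cases "k = 0")
  case False
  define q where "q = nome s N"
  define x where "x = \<bar>of_int k :: real\<bar>"
  define n where "n = nat \<bar>k\<bar>"
  define M where "M = (of_int N :: real)"
  have M: "M \<ge> 1" using N by (simp add: M_def)
  have x: "x \<ge> 1" using False unfolding x_def by linarith
  have n: "n \<ge> 1" using False by (simp add: n_def)
  note q = nome_bounds[OF N s, folded q_def]
  have w: "weight s N k \<le> 2 powr (s / 2) * (M powr s * x powr s)"
  proof -
    have "1 \<le> M\<^sup>2 * x\<^sup>2" using mult_mono[of 1 "M\<^sup>2" 1 "x\<^sup>2"] M x by simp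
    hence "1 + ((of_int (N * k))\<^sup>2 + 0\<^sup>2) \<le> 2 * (M * x)\<^sup>2"
      by (simp add: M_def x_def power_mult_distrib)
    hence "weight s N k \<le> (2 * (M * x)\<^sup>2) powr (s / 2)"
      unfolding weight_def J_symbol_def using s by (intro powr_mono2) auto
    also have "(M * x)\<^sup>2 = (M * x) powr 2" using M x by simp
    also have "(2 * (M * x) powr 2) powr (s / 2) = 2 powr (s / 2) * ((M * x) powr 2) powr (s / 2)"
      by (rule powr_mult)
    also have "((M * x) powr 2) powr (s / 2) = (M * x) powr s"
      unfolding powr_powr by simp
    also have "\<dots> = M powr s * x powr s" by (rule powr_mult)
    finally show ?thesis .
  qed
  have c: "cnoidal (decay_rate s N) k \<le> 8 / 3 * (x * (M powr (- (s + 2)) * (1 / 2) ^ n))"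
  proof -
    have "exp (- 2 * decay_rate s N) = q\<^sup>2"       using q(3) exp_add[of "- decay_rate s N" "- decay_rate s N"] by (simp add: power2_eq_square)
    moreover have "q\<^sup>2 \<le> (1 / 2)\<^sup>2" using q by (intro power_mono) auto
    ultimately have "2 / (1 - exp (- 2 * decay_rate s N)) \<le> 2 / (3 / 4)"
      by (intro divide_left_mono) (auto simp: power2_eq_square)
    moreover have "q ^ n \<le> M powr (- (s + 2)) * (1 / 2) ^ n"
    proof -
      have "M powr (- (s + 2)) \<le> M powr 0" using M s by (intro powr_mono) auto
      hence "(M powr (- (s + 2))) ^ n \<le> M powr (- (s + 2))"
        using n M power_decreasing[of 1 n "M powr (- (s + 2))"] by simp
      thus ?thesis by (simp add: q_def nome_def M_def power_divide divide_right_mono)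
    qed
    ultimately have "2 / (1 - exp (- 2 * decay_rate s N)) * (x * q ^ n) \<le>
        2 / (3 / 4) * (x * (M powr (- (s + 2)) * (1 / 2) ^ n))"
      using x q by (intro mult_mono) auto
    thus ?thesis using cnoidal_bound(2)[OF q(4), of k] by (simp add: q(3) x_def n_def)
  qed
  have "weight s N k * (6 * M ^ 2 * cnoidal (decay_rate s N) k) \<le>
      (2 powr (s / 2) * (M powr s * x powr s)) * (6 * M ^ 2 * (8 / 3 * (x * (M powr (- (s + 2)) * (1 / 2) ^ n))))"
    using weight_pos[of s N k] cnoidal_bound(1)[OF q(4), of k]
    by (intro mult_mono w mult_left_mono c) auto
  also have "\<dots> = 16 * 2 powr (s / 2) * ((M powr s * M powr 2 * M powr (- (s + 2))) * (x powr s * x powr 1) * (1 / 2) ^ n)"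
    using M x by simp
  also have "M powr s * M powr 2 * M powr (- (s + 2)) = 1"
    using M by (intro powr_scaling_cancel) simp
  also have "x powr s * x powr 1 = x powr (s + 1)" by (simp only: powr_add)
  finally show ?thesis by (simp add: majorant_def x_def n_def M_def)
qed (simp add: majorant_def)

lemma weight_0 [simp]: "weight s N 0 = 1"
  by (simp add: weight_def J_symbol_def)

lemma weight_wave_coeffs_le:
  assumes "N \<ge> 1" "s \<ge> 0" "d \<ge> 0"
  shows "weight s N k * norm (wave_coeffs (decay_rate s N) N d t k) \<le> majorant s k + (if k = 0 then d else 0)"
  using weight_profile_le_majorant[OF assms(1,2), of k] assms cnoidal_bound(1)[OF nome_bounds(4)[OF assms(1,2)], of k]
  by (cases "k = 0") (simp_all add: norm_wave_coeffs profile_def majorant_def)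

lemma has_sum_at_0: "((\<lambda>k::int. if k = 0 then d else 0) has_sum (d::real)) UNIV"
  by (rule has_sum_finite_neutralI[of "{0}"]) auto

lemma Hs_wave_coeffsI:
  assumes "hermitian c" "\<And>k. weight s N k * norm (c k) \<le> B k" "B summable_on UNIV"
  shows "Hs_wave_coeffs s N c"
  unfolding Hs_wave_coeffs_def
  using summable_on_comparison_test[OF assms(3), of "\<lambda>k. weight s N k * norm (c k)"] assms(1,2) weight_pos[of s N]
  by (auto simp: less_imp_le)

lemma Hs_norm_wave_le_majorant:
  assumes "s \<ge> 0" "hermitian c" "\<And>k. weight s N k * norm (c k) \<le> B k" "(B has_sum T) UNIV"
  shows "Hs_norm s (wave N c) \<le> 2 * pi * T"
proof -
  have B: "B summable_on UNIV" using assms(4) by (rule has_sum_imp_summable)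
  have c: "Hs_wave_coeffs s N c" by (rule Hs_wave_coeffsI[OF assms(2,3) B])
  have "(\<Sum>\<^sub>\<infinity>k. weight s N k * norm (c k)) \<le> (\<Sum>\<^sub>\<infinity>k. B k)"
    using c B assms(3) by (intro infsum_mono) (auto simp: Hs_wave_coeffs_def)
  also have "\<dots> = T" using assms(4) by (rule infsumI)
  finally have "2 * pi * (\<Sum>\<^sub>\<infinity>k. weight s N k * norm (c k)) \<le> 2 * pi * T" by simp
  with Hs_norm_wave_le[OF assms(1) c] show ?thesis by linarith
qed

definition majorant_sum :: "real \<Rightarrow> real" where
  "majorant_sum s = (\<Sum>\<^sub>\<infinity>k. majorant s k)"

lemma hermitian_diff: "hermitian c \<Longrightarrow> hermitian c' \<Longrightarrow> hermitian (\<lambda>k. c k - c' k)"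
  by (simp add: hermitian_def)

lemma norm_cis_diff_le: "norm (cis x - cis y) \<le> \<bar>x - y\<bar>"
proof -
  have "(norm (cis x - cis y))\<^sup>2 = (cos x - cos y)\<^sup>2 + (sin x - sin y)\<^sup>2"
    by (simp add: cmod_def)
  also have "\<dots> = 2 - 2 * cos (x - y)"
    using sin_cos_squared_add[of x] sin_cos_squared_add[of y]
    by (simp add: cos_diff power2_diff algebra_simps)
  also have "\<dots> = (2 * sin ((x - y) / 2))\<^sup>2"
  proof -
    define h where "h = (x - y) / 2"
    have "x - y = 2 * h" by (simp add: h_def)
    thus ?thesis using cos_double_sin[of h] by (simp add: h_def[symmetric] power_mult_distrib)
  qed
  also have "\<dots> \<le> (x - y)\<^sup>2"
  proof -
    have "\<bar>sin ((x - y) / 2)\<bar> \<le> \<bar>(x - y) / 2\<bar>"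
      by (rule abs_sin_x_le_abs_x)
    hence "\<bar>2 * sin ((x - y) / 2)\<bar> \<le> \<bar>x - y\<bar>" by simp
    thus ?thesis by (rule abs_le_square_iff[THEN iffD1])
  qed
  finally show ?thesis using abs_le_square_iff[of "norm (cis x - cis y)" "x - y"] by simp
qed

lemma Hs_norm_nonneg: "Hs_norm s f \<ge> 0"
  by (simp add: Hs_norm_def torus_L2_norm_eq)

lemma half_le_sin:
  assumes "0 \<le> t" "t \<le> 1" shows "t / 2 \<le> sin (t :: real)"
proof -
  have "\<bar>sin t - t\<bar> \<le> t ^ 3 / 6"
    using Maclaurin_sin_bound[of t 3] assms by (simp add: sin_coeff_def eval_nat_numeral fact_numeral field_simps)
  moreover have "t ^ 3 \<le> t ^ 1" using assms by (intro power_decreasing) auto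
  ultimately show ?thesis using assms unfolding power_one_right by linarith
qed

context
  fixes s :: real and N :: int
  assumes N: "N \<ge> 1" and s: "s \<ge> 0"
begin

lemma wave_coeffs_Hs:
  assumes "d \<ge> 0"
  shows "Hs_wave_coeffs s N (wave_coeffs (decay_rate s N) N d t)"
  by (rule Hs_wave_coeffsI[OF wave_coeffs_hermitian weight_wave_coeffs_le[OF N s assms]])
     (intro summable_on_add majorant_summable has_sum_imp_summable[OF has_sum_at_0])

lemma Hs_norm_cnoidal_wave_le:
  assumes "d \<ge> 0"
  shows "Hs_norm s (cnoidal_wave (decay_rate s N) N d t) \<le> 2 * pi * (majorant_sum s + d)"
  unfolding cnoidal_wave_def
  by (rule Hs_norm_wave_le_majorant[OF s wave_coeffs_hermitian weight_wave_coeffs_le[OF N s assms]])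
     (auto simp: majorant_sum_def intro!: has_sum_add has_sum_at_0 has_sum_infsum majorant_summable)

lemma cnoidal_wave_diff:
  assumes "d \<ge> 0" "d' \<ge> 0"
  shows "(\<lambda>z. cnoidal_wave (decay_rate s N) N d t z - cnoidal_wave (decay_rate s N) N d' t' z) =
     wave N (\<lambda>k. wave_coeffs (decay_rate s N) N d t k - wave_coeffs (decay_rate s N) N d' t' k)"
  unfolding cnoidal_wave_def
  by (intro ext wave_diff Hs_wave_coeffs_summable[OF s wave_coeffs_Hs] assms)

text \<open>
  The Lipschitz constant depends on \<open>N\<close>, which is harmless since it only serves the continuity in
  time of each single wave. The extra factor \<open>\<bar>k\<bar>\<close> from differentiating the phase is absorbed by the
  geometric decay.
\<close>

lemma cnoidal_wave_continuous_time:
  assumes d: "d \<ge> 0"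
  shows "\<exists>L. \<forall>t t'. Hs_norm s (\<lambda>z. cnoidal_wave (decay_rate s N) N d t z - cnoidal_wave (decay_rate s N) N d t' z) \<le> L * \<bar>t - t'\<bar>"
proof -
  define S where "S = speed (decay_rate s N) N d"
  define K where "K = 16 * 2 powr (s / 2) * \<bar>of_int N * S\<bar>"
  define T where "T = (\<Sum>\<^sub>\<infinity>k::int. \<bar>of_int k\<bar> powr (s + 2) * (1 / 2 :: real) ^ nat \<bar>k\<bar>)"
  have T: "((\<lambda>k::int. \<bar>of_int k\<bar> powr (s + 2) * (1 / 2 :: real) ^ nat \<bar>k\<bar>) has_sum T) UNIV"
    unfolding T_def by (intro has_sum_infsum summable_on_int_powr_times_power) auto
  have "Hs_norm s (\<lambda>z. cnoidal_wave (decay_rate s N) N d t z - cnoidal_wave (decay_rate s N) N d t' z) \<le>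
      2 * pi * (K * \<bar>t - t'\<bar> * T)" for t t'
    unfolding cnoidal_wave_diff[OF d d]
  proof (rule Hs_norm_wave_le_majorant[OF s])
    show "hermitian (\<lambda>k. wave_coeffs (decay_rate s N) N d t k - wave_coeffs (decay_rate s N) N d t' k)"
      by (intro hermitian_diff wave_coeffs_hermitian)
    show "((\<lambda>k. K * \<bar>t - t'\<bar> * (\<bar>of_int k\<bar> powr (s + 2) * (1 / 2) ^ nat \<bar>k\<bar>)) has_sum K * \<bar>t - t'\<bar> * T) UNIV"
      by (rule has_sum_cmult_right[OF T])
    fix k :: int
    show "weight s N k * norm (wave_coeffs (decay_rate s N) N d t k - wave_coeffs (decay_rate s N) N d t' k) \<le>
        K * \<bar>t - t'\<bar> * (\<bar>of_int k\<bar> powr (s + 2) * (1 / 2) ^ nat \<bar>k\<bar>)"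
    proof (cases "k = 0")
      case True
      thus ?thesis by (simp add: wave_coeffs_def)
    next
      case False
      define c where "c = 6 * of_int N ^ 2 * cnoidal (decay_rate s N) k"
      have c: "c \<ge> 0" using cnoidal_bound(1)[OF nome_bounds(4)[OF N s], of k] by (simp add: c_def)
      have "wave_coeffs (decay_rate s N) N d t k - wave_coeffs (decay_rate s N) N d t' k =
          of_real c * (cis (- (of_int (N * k) * (S * t))) - cis (- (of_int (N * k) * (S * t'))))"
        using False by (simp add: wave_coeffs_def profile_def S_def c_def right_diff_distrib)
      hence "norm (wave_coeffs (decay_rate s N) N d t k - wave_coeffs (decay_rate s N) N d t' k) =
          c * norm (cis (- (of_int (N * k) * (S * t))) - cis (- (of_int (N * k) * (S * t'))))"
        using c by (simp add: norm_mult)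
      also have "\<dots> \<le> c * \<bar>- (of_int (N * k) * (S * t)) - - (of_int (N * k) * (S * t'))\<bar>"
        by (intro mult_left_mono norm_cis_diff_le c)
      also have "- (of_int (N * k) * (S * t)) - - (of_int (N * k) * (S * t')) = (of_int N * S) * of_int k * (t' - t)"
        by (simp add: algebra_simps)
      also have "\<bar>(of_int N * S) * of_int k * (t' - t)\<bar> = \<bar>of_int N * S\<bar> * \<bar>of_int k\<bar> * \<bar>t - t'\<bar>"
        by (simp add: abs_mult abs_minus_commute)
      finally have "weight s N k * norm (wave_coeffs (decay_rate s N) N d t k - wave_coeffs (decay_rate s N) N d t' k) \<le>
          weight s N k * (c * (\<bar>of_int N * S\<bar> * \<bar>of_int k\<bar> * \<bar>t - t'\<bar>))"
        using weight_pos[of s N k] by (intro mult_left_mono) auto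
      also have "\<dots> = (weight s N k * c) * (\<bar>of_int N * S\<bar> * \<bar>of_int k\<bar> * \<bar>t - t'\<bar>)" by simp
      also have "\<dots> \<le> majorant s k * (\<bar>of_int N * S\<bar> * \<bar>of_int k\<bar> * \<bar>t - t'\<bar>)"
        unfolding c_def by (intro mult_right_mono weight_profile_le_majorant N s) auto
      also have "\<dots> = K * \<bar>t - t'\<bar> * ((\<bar>of_int k\<bar> powr (s + 1) * \<bar>of_int k\<bar> powr 1) * (1 / 2) ^ nat \<bar>k\<bar>)"
        by (simp add: K_def majorant_def)
      also have "\<bar>of_int k\<bar> powr (s + 1) * \<bar>of_int k\<bar> powr 1 = \<bar>of_int k :: real\<bar> powr (s + 2)"
        by (simp only: powr_add[symmetric]) (simp add: add.assoc)
      finally show ?thesis .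
    qed
  qed
  hence "\<forall>t t'. Hs_norm s (\<lambda>z. cnoidal_wave (decay_rate s N) N d t z - cnoidal_wave (decay_rate s N) N d t' z) \<le>
      (2 * pi * K * T) * \<bar>t - t'\<bar>" by (simp add: mult_ac)
  thus ?thesis by blast
qed

lemma ZK_solution_cnoidal_wave:
  assumes d: "d \<ge> 0"
  shows "ZK_solution s (cnoidal_wave (decay_rate s N) N d)"
proof -
  have "((\<lambda>\<tau>. Hs_norm s (\<lambda>z. cnoidal_wave (decay_rate s N) N d \<tau> z - cnoidal_wave (decay_rate s N) N d t z)) \<longlongrightarrow> 0)
      (at t within {0..1})" for t
  proof -
    obtain L where L: "\<And>t t'. Hs_norm s (\<lambda>z. cnoidal_wave (decay_rate s N) N d t z - cnoidal_wave (decay_rate s N) N d t' z) \<le> L * \<bar>t - t'\<bar>"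
      using cnoidal_wave_continuous_time[OF d] by blast
    have "((\<lambda>\<tau>. L * \<bar>\<tau> - t\<bar>) \<longlongrightarrow> L * \<bar>t - t\<bar>) (at t within {0..1})"
      by (intro tendsto_intros)
    hence "((\<lambda>\<tau>. L * \<bar>\<tau> - t\<bar>) \<longlongrightarrow> 0) (at t within {0..1})" by simp
    thus ?thesis
      by (rule tendsto_sandwich[OF _ _ tendsto_const, rotated 2]) (auto simp: L Hs_norm_nonneg)
  qed
  moreover have "cnoidal_wave (decay_rate s N) N d t \<in> Hs s" for t
    unfolding cnoidal_wave_def by (rule wave_in_Hs[OF s wave_coeffs_Hs[OF d]])
  ultimately show ?thesis
    using ZK_distributional_cnoidal_wave[OF nome_bounds(4)[OF N s]]
    by (simp add: ZK_solution_def C_unit_Hs_def)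
qed

text \<open>
  At time zero the phases agree and the two waves differ by the constant \<open>d\<close> only.
\<close>

lemma Hs_norm_initial_diff_le:
  assumes d: "d \<ge> 0"
  shows "Hs_norm s (\<lambda>z. cnoidal_wave (decay_rate s N) N d 0 z - cnoidal_wave (decay_rate s N) N 0 0 z) \<le> 2 * pi * d"
  unfolding cnoidal_wave_diff[OF d order_refl]
proof (rule Hs_norm_wave_le_majorant[OF s _ _ has_sum_at_0])
  show "weight s N k * norm (wave_coeffs (decay_rate s N) N d 0 k - wave_coeffs (decay_rate s N) N 0 0 k) \<le> (if k = 0 then d else 0)" for k
    using d by (simp add: wave_coeffs_def profile_def)
qed (intro hermitian_diff wave_coeffs_hermitian)

text \<open>
  The lower counterpart, at the fundamental mode, of the uniform upper bound: it uses
  \<open>1 / sinh a \<ge> 2 exp (-a)\<close>.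
\<close>

lemma weight_amplitude_ge: "6 \<le> weight s N 1 * (6 * of_int N ^ 2 * cnoidal (decay_rate s N) 1)"
proof -
  define M where "M = (of_int N :: real)"
  define q where "q = nome s N"
  have M: "M \<ge> 1" using N by (simp add: M_def)
  note q = nome_bounds[OF N s, folded q_def]
  have "weight s N 1 \<ge> (M\<^sup>2) powr (s / 2)"
    unfolding weight_def J_symbol_def using s by (intro powr_mono2) (auto simp: M_def)
  also have "(M\<^sup>2) powr (s / 2) = (M powr 2) powr (s / 2)" using M by simp
  also have "\<dots> = M powr s" by (simp add: powr_powr)
  finally have w: "weight s N 1 \<ge> M powr s" .
  have "exp (decay_rate s N) = 1 / q"
    using exp_minus_inverse[of "decay_rate s N"] q(1,3) by (simp add: field_simps)
  hence "2 * sinh (decay_rate s N) = 1 / q - q"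
    using q(3) by (simp add: sinh_field_def)
  hence "2 * sinh (decay_rate s N) \<le> 1 / q" using q(1) by simp
  hence "sinh (decay_rate s N) \<le> 1 / (2 * q)" using q(1) by (simp add: field_simps)
  hence "1 / (1 / (2 * q)) \<le> 1 / sinh (decay_rate s N)"
    using q by (intro divide_left_mono) auto
  hence c: "2 * q \<le> cnoidal (decay_rate s N) 1" by (simp add: cnoidal_def)
  have "6 = 6 * (M powr s * M powr 2 * M powr (- (s + 2)))"
    using M powr_scaling_cancel[of M s] by simp
  also have "\<dots> = M powr s * (6 * M ^ 2 * (2 * q))"
    using M by (simp add: q_def nome_def M_def)
  also have "\<dots> \<le> weight s N 1 * (6 * M ^ 2 * cnoidal (decay_rate s N) 1)"
    using q(1) weight_pos[of s N 1] by (intro mult_mono w mult_left_mono c) auto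
  finally show ?thesis by (simp add: M_def)
qed

text \<open>
  The speeds differ by \<open>d = 1 / N\<close>, so at time \<open>t\<close> the fundamental modes, of frequency \<open>N\<close>, are out of
  phase by the angle \<open>t\<close>, whatever \<open>N\<close> is. This single mode has amplitude of order one in \<open>H\<^sup>s\<close> and
  already separates the two waves.
\<close>

lemma Hs_norm_diff_ge:
  assumes t: "t \<in> {0..1}"
  shows "t \<le> Hs_norm s (\<lambda>z. cnoidal_wave (decay_rate s N) N (1 / of_int N) t z - cnoidal_wave (decay_rate s N) N 0 t z)"
proof -
  define d where "d = 1 / (of_int N :: real)"
  have d: "d \<ge> 0" "of_int N * d = 1" using N by (auto simp: d_def)
  define c where "c = 6 * of_int N ^ 2 * cnoidal (decay_rate s N) 1"
  define \<theta> where "\<theta> = of_int N * (speed (decay_rate s N) N 0 * t)"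
  define \<Delta> where "\<Delta> k = wave_coeffs (decay_rate s N) N d t k - wave_coeffs (decay_rate s N) N 0 t k" for k
  have c: "c \<ge> 0" using cnoidal_bound(1)[OF nome_bounds(4)[OF N s], of 1] by (simp add: c_def)
  have \<Delta>: "Hs_wave_coeffs s N \<Delta>"
  proof (rule Hs_wave_coeffsI)
    show "hermitian \<Delta>" unfolding \<Delta>_def by (intro hermitian_diff wave_coeffs_hermitian)
    have "weight s N k * norm (\<Delta> k) \<le> weight s N k * norm (wave_coeffs (decay_rate s N) N d t k) +
        weight s N k * norm (wave_coeffs (decay_rate s N) N 0 t k)" for k
      unfolding distrib_left[symmetric] \<Delta>_def using weight_pos[of s N k]
      by (intro mult_left_mono norm_triangle_ineq4) auto
    thus "weight s N k * norm (\<Delta> k) \<le> (majorant s k + (if k = 0 then d else 0)) + majorant s k" for k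
      using weight_wave_coeffs_le[OF N s d(1), of k t] weight_wave_coeffs_le[OF N s order_refl, of k t, simplified]
      by (smt (verit))
    show "(\<lambda>k. (majorant s k + (if k = 0 then d else 0)) + majorant s k) summable_on UNIV"
      by (intro summable_on_add majorant_summable has_sum_imp_summable[OF has_sum_at_0])
  qed
  have "of_int N * (speed (decay_rate s N) N d * t) = \<theta> + (of_int N * d) * t"
    by (simp add: \<theta>_def speed_def algebra_simps)
  hence "\<Delta> 1 = of_real c * (cis (- (\<theta> + t)) - cis (- \<theta>))"
    by (simp add: \<Delta>_def wave_coeffs_def profile_def c_def \<theta>_def d(2) right_diff_distrib)
  also have "cis (- (\<theta> + t)) - cis (- \<theta>) = cis (- \<theta>) * (cis (- t) - 1)"
    by (simp add: right_diff_distrib cis_mult)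
  finally have "norm (\<Delta> 1) = c * norm (cis (- t) - 1)" using c by (simp add: norm_mult)
  moreover have "t / 2 \<le> norm (cis (- t) - 1)"
    using abs_Im_le_cmod[of "cis (- t) - 1"] half_le_sin[of t] t by simp
  ultimately have "c * (t / 2) \<le> norm (\<Delta> 1)" using mult_left_mono[of "t / 2" "norm (cis (- t) - 1)" c] c by simp
  hence "weight s N 1 * (c * (t / 2)) \<le> weight s N 1 * norm (\<Delta> 1)"
    using weight_pos[of s N 1] by (intro mult_left_mono) auto
  moreover have "6 * (t / 2) \<le> (weight s N 1 * c) * (t / 2)"
    unfolding c_def using weight_amplitude_ge t by (intro mult_right_mono) auto
  ultimately have "3 * t \<le> weight s N 1 * norm (\<Delta> 1)" by simp
  moreover have "1 * (weight s N 1 * norm (\<Delta> 1)) \<le> 2 * pi * (weight s N 1 * norm (\<Delta> 1))"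
    using weight_pos[of s N 1] pi_gt3 by (intro mult_right_mono) auto
  moreover have "2 * pi * (weight s N 1 * norm (\<Delta> 1)) \<le> Hs_norm s (wave N \<Delta>)"
    by (rule Hs_norm_wave_ge[OF s \<Delta>]) (use N in auto)
  ultimately have "t \<le> Hs_norm s (wave N \<Delta>)" using t by simp
  thus ?thesis using cnoidal_wave_diff[OF d(1) order_refl, of t t] by (simp add: \<Delta>_def[abs_def] d_def)
qed

end

theorem theorem1p2:
  fixes s :: real
  assumes "s > 5 / 3"
  shows "\<exists>(c::real) (C::real) (u :: nat \<Rightarrow> real \<Rightarrow> real \<times> real \<Rightarrow> real)
            (v :: nat \<Rightarrow> real \<Rightarrow> real \<times> real \<Rightarrow> real).
           c > 0 \<and> C > 0 \<and>
           (\<forall>m. ZK_solution s (u m) \<and> ZK_solution s (v m)) \<and>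
           (\<forall>m. (SUP t\<in>{0..1}. ereal (Hs_norm s (u m t) + Hs_norm s (v m t))) \<le> ereal C) \<and>
           (\<lambda>m. Hs_norm s (\<lambda>z. u m 0 z - v m 0 z)) \<longlonglongrightarrow> 0 \<and>
           (\<forall>t\<in>{0..1}. liminf (\<lambda>m. ereal (Hs_norm s (\<lambda>z. u m t z - v m t z))) \<ge> ereal (c * t))"
proof -
  have s: "s \<ge> 0" using assms by simp
  define N where "N m = int (Suc m)" for m
  define d where "d m = 1 / (of_int (N m) :: real)" for m
  define u where "u m = cnoidal_wave (decay_rate s (N m)) (N m) (d m)" for m
  define v where "v m = cnoidal_wave (decay_rate s (N m)) (N m) 0" for m
  define C where "C = 2 * (2 * pi * (majorant_sum s + 1))"
  have N: "N m \<ge> 1" for m by (simp add: N_def)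
  have d: "d m \<ge> 0" "d m \<le> 1" for m by (simp_all add: d_def N_def)
  have "majorant_sum s \<ge> 0" unfolding majorant_sum_def by (intro infsum_nonneg majorant_nonneg)
  hence C: "C > 0" by (simp add: C_def)
  have sol: "ZK_solution s (u m)" "ZK_solution s (v m)" for m
    unfolding u_def v_def by (intro ZK_solution_cnoidal_wave N s d order_refl)+
  have "Hs_norm s (u m t) + Hs_norm s (v m t) \<le> C" for m t
  proof -
    have "Hs_norm s (u m t) \<le> 2 * pi * (majorant_sum s + d m)"
      unfolding u_def by (intro Hs_norm_cnoidal_wave_le N s d)
    also have "\<dots> \<le> 2 * pi * (majorant_sum s + 1)" using d by simp
    finally have 1: "Hs_norm s (u m t) \<le> 2 * pi * (majorant_sum s + 1)" .
    have "Hs_norm s (v m t) \<le> 2 * pi * (majorant_sum s + 0)"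
      unfolding v_def by (intro Hs_norm_cnoidal_wave_le N s order_refl)
    also have "\<dots> \<le> 2 * pi * (majorant_sum s + 1)" by simp
    finally show ?thesis using 1 by (simp add: C_def)
  qed
  hence sup: "(SUP t\<in>{0..1}. ereal (Hs_norm s (u m t) + Hs_norm s (v m t))) \<le> ereal C" for m
    by (intro SUP_least) simp
  have init: "(\<lambda>m. Hs_norm s (\<lambda>z. u m 0 z - v m 0 z)) \<longlonglongrightarrow> 0"
  proof (rule tendsto_sandwich[OF _ _ tendsto_const])
    show "\<forall>\<^sub>F m in sequentially. Hs_norm s (\<lambda>z. u m 0 z - v m 0 z) \<le> 2 * pi * d m"
      unfolding u_def v_def by (intro always_eventually allI Hs_norm_initial_diff_le N s d)
    have "(\<lambda>m. 2 * pi * (1 / real (Suc m))) \<longlonglongrightarrow> 2 * pi * 0"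
      by (intro tendsto_mult tendsto_const LIMSEQ_Suc[OF lim_1_over_n])
    thus "(\<lambda>m. 2 * pi * d m) \<longlonglongrightarrow> 0" by (simp add: d_def N_def)
  qed (auto simp: Hs_norm_nonneg)
  have "ereal (1 * t) \<le> liminf (\<lambda>m. ereal (Hs_norm s (\<lambda>z. u m t z - v m t z)))" if "t \<in> {0..1}" for t
    using Hs_norm_diff_ge[OF N s that]
    by (intro Liminf_bounded always_eventually allI) (simp add: u_def v_def d_def)
  with C sol sup init show ?thesis
    by (intro exI[of _ 1] exI[of _ C] exI[of _ u] exI[of _ v]) simp
qed

end
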